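(* Let $k$ be an infinite field, $R=k[x_1,\ldots,x_m]$ and $I\subsetneq R$ a homogeneous ideal. For any term order of $R$ we have $$r(R/I)\le r(R/\operatorname{in}(I)),$$ where $\operatorname{in}(I)$ denotes the initial ideal of $I$ with respect to the given term order.
   Context: For a standard graded $k$-algebra $A$, a reduction of $A$ is an ideal $Q$ generated by linear forms (elements of $A_1$) such that $Q_n=A_n$ for all large $n$. The reduction number $r_Q(A)$ of $A$ with respect to $Q$ is the least $n\ge0$ with $Q_{n+1}=A_{n+1}$. A reduction is minimal if it contains no other reduction (equivalently, it is a reduction generated by $\dim A$ linear forms). The reduction number is $r(A)=\min\{r_Q(A)\mid Q\text{ a minimal reduction of }A\}$. *)

theory Defs
  imports "HOL-Library.Poly_Mapping" "HOL-Algebra.Algebraic_Closure_Type"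
begin

section \<open>Standard graded algebras and reductions\<close>

text \<open>
  A graded algebra is passed as a ring \<open>A\<close> together with its grading
  \<open>gr :: nat \<Rightarrow> 'a set\<close>, where \<open>gr n\<close> is the homogeneous component
  \<open>A\<^sub>n \<subseteq> carrier A\<close>. For a homogeneous ideal \<open>Q\<close>, such as one generated by linear forms,
  the component \<open>Q\<^sub>n\<close> is \<open>Q \<inter> A\<^sub>n\<close>.
\<close>

definition is_reduction :: "('a, 'b) ring_scheme \<Rightarrow> (nat \<Rightarrow> 'a set) \<Rightarrow> 'a set \<Rightarrow> bool" where
  "is_reduction A gr Q \<longleftrightarrow>
     (\<exists>S. S \<subseteq> gr 1 \<and> Q = genideal A S) \<and> (\<exists>N. \<forall>n\<ge>N. Q \<inter> gr n = gr n)"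

definition reduction_number_wrt ::
    "('a, 'b) ring_scheme \<Rightarrow> (nat \<Rightarrow> 'a set) \<Rightarrow> 'a set \<Rightarrow> nat" where
  "reduction_number_wrt A gr Q = (LEAST n. Q \<inter> gr (n + 1) = gr (n + 1))"

definition is_minimal_reduction ::
    "('a, 'b) ring_scheme \<Rightarrow> (nat \<Rightarrow> 'a set) \<Rightarrow> 'a set \<Rightarrow> bool" where
  "is_minimal_reduction A gr Q \<longleftrightarrow>
     is_reduction A gr Q \<and> \<not> (\<exists>Q'. is_reduction A gr Q' \<and> Q' \<subset> Q)"

text \<open>
  Minimal reductions of a standard graded algebra always exist (the ideal generated by
  \<open>A\<^sub>1\<close> is a reduction and \<open>A\<^sub>1\<close> is finite-dimensional), so the infimum below is the
  minimum of a nonempty set of natural numbers.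
\<close>

definition reduction_number :: "('a, 'b) ring_scheme \<Rightarrow> (nat \<Rightarrow> 'a set) \<Rightarrow> nat" where
  "reduction_number A gr = Inf {reduction_number_wrt A gr Q | Q. is_minimal_reduction A gr Q}"


section \<open>Polynomial rings and homogeneous ideals\<close>

text \<open>
  Monomials in the variables indexed by the finite type \<open>'n\<close> (so \<open>m = CARD('n)\<close>) are
  exponent vectors \<open>'n \<Rightarrow>\<^sub>0 nat\<close>; multiplication of monomials is addition of exponents.
\<close>

type_synonym 'n monomial = "'n \<Rightarrow>\<^sub>0 nat"

type_synonym ('n, 'k) mpoly = "'n monomial \<Rightarrow>\<^sub>0 'k"

abbreviation mpoly_ring :: "('n::finite, 'k::field) mpoly ring" where
  "mpoly_ring \<equiv> ring_of_type_algebra"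

definition total_degree :: "('n::finite) monomial \<Rightarrow> nat" where
  "total_degree t = (\<Sum>i\<in>UNIV. Poly_Mapping.lookup t i)"

text \<open>The zero polynomial is homogeneous of every degree.\<close>

definition homogeneous_of_degree :: "nat \<Rightarrow> ('n::finite, 'k::field) mpoly \<Rightarrow> bool" where
  "homogeneous_of_degree n f \<longleftrightarrow> (\<forall>t\<in>Poly_Mapping.keys f. total_degree t = n)"

definition homogeneous_ideal :: "('n::finite, 'k::field) mpoly set \<Rightarrow> bool" where
  "homogeneous_ideal I \<longleftrightarrow>
     (\<exists>S. (\<forall>f\<in>S. \<exists>n. homogeneous_of_degree n f) \<and> I = genideal mpoly_ring S)"

text \<open>The component \<open>(R/I)\<^sub>n\<close>: the image of \<open>R\<^sub>n\<close> in \<open>R/I\<close>.\<close>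

definition quotient_grading ::
    "('n::finite, 'k::field) mpoly set \<Rightarrow> nat \<Rightarrow> ('n, 'k) mpoly set set" where
  "quotient_grading I n = {I +>\<^bsub>mpoly_ring\<^esub> f | f. homogeneous_of_degree n f}"


section \<open>Term orders and initial ideals\<close>

text \<open>The pair \<open>(s, t)\<close> belongs to \<open>ord\<close> iff \<open>x\<^sup>s \<le> x\<^sup>t\<close>.\<close>

definition term_order :: "('n::finite) monomial rel \<Rightarrow> bool" where
  "term_order ord \<longleftrightarrow>
     linear_order ord \<and> (\<forall>t. (0, t) \<in> ord) \<and>
     (\<forall>s t u. (s, t) \<in> ord \<longrightarrow> (s + u, t + u) \<in> ord)"

definition initial_monomial ::
    "('n::finite) monomial rel \<Rightarrow> ('n, 'k::field) mpoly \<Rightarrow> 'n monomial" where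
  "initial_monomial ord f = (THE t. t \<in> Poly_Mapping.keys f \<and> (\<forall>s\<in>Poly_Mapping.keys f. (s, t) \<in> ord))"

definition initial_ideal ::
    "('n::finite) monomial rel \<Rightarrow> ('n, 'k::field) mpoly set \<Rightarrow> ('n, 'k) mpoly set" where
  "initial_ideal ord I =
     genideal mpoly_ring {Poly_Mapping.single (initial_monomial ord f) 1 | f. f \<in> I \<and> f \<noteq> 0}"

end

theory Submission
  imports Defs "Jordan_Normal_Form.Determinant"
begin

text \<open>
  Let \<open>Z\<close> be linear forms giving a minimal reduction of \<open>R/in(I)\<close> with reduction number \<open>r\<close>.
  Rescale the variables by \<open>x\<^sub>i \<mapsto> u\<^sub>i x\<^sub>i\<close> in \<open>Z\<close>. Choose a basis of \<open>R\<^bsub>r+1\<^esub>\<close> consisting of initial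
  monomials of \<open>I\<close> and of multiples of elements of \<open>Z\<close>; replace the former by elements of \<open>I\<close> with
  these initial monomials and rescale the latter. The determinant of the new family is a
  polynomial in \<open>u\<close> one of whose coefficients is the determinant of the original basis, so for
  some \<open>u\<close> the rescaled forms \<open>Z\<^sub>u\<close> satisfy \<open>R\<^bsub>r+1\<^esub> \<subseteq> I + (Z\<^sub>u)\<close>.

  The reduction of \<open>R/I\<close> given by \<open>Z\<^sub>u\<close> is minimal because no reduction of \<open>R/I\<close> has fewer
  generators than \<open>Z\<close>: by minimality \<open>Z\<close> is algebraically independent modulo \<open>in(I)\<close> (Noether
  normalization over an infinite field), which forces many standard monomials of \<open>I\<close>, whereas a
  reduction with few generators bounds their number.
\<close>

section \<open>Reductions of a quotient as ideals of the polynomial ring\<close>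

text \<open>With the polynomial ring as a module over itself, \<open>R.subspace\<close> means ideal
  and \<open>R.span\<close> means generated ideal, so the general theory of spans applies to
  ideals.\<close>

interpretation R: Modules.module "(*) :: ('n::finite, 'k::field) mpoly \<Rightarrow> _"
  by unfold_locales (auto simp: algebra_simps)

text \<open>As a rewrite rule this would undo \<open>mult.assoc\<close>.\<close>
declare R.scale_scale [simp del]

text \<open>A second module structure on the same type: scalars act as constant polynomials, so
  \<open>K.span\<close> is the k-linear span whereas \<open>R.span\<close> is the generated
  ideal.\<close>

definition kscale :: "'k \<Rightarrow> ('n::finite, 'k::field) mpoly \<Rightarrow> ('n, 'k) mpoly" where
  "kscale c f = Poly_Mapping.single 0 c * f"

lemma lookup_kscale [simp]: "Poly_Mapping.lookup (kscale c f) t = c * Poly_Mapping.lookup f t"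
proof -
  have "kscale c f = Poly_Mapping.map ((*) c) f"
    by (simp add: kscale_def mult_map_scale_conv_mult)
  then show ?thesis by (simp add: map.rep_eq when_def)
qed

interpretation K: Vector_Spaces.vector_space "kscale :: 'k \<Rightarrow> ('n::finite, 'k::field) mpoly \<Rightarrow> _"
  by unfold_locales (auto intro!: poly_mapping_eqI simp: lookup_add algebra_simps)

abbreviation xpow :: "'n monomial \<Rightarrow> ('n::finite, 'k::field) mpoly" where
  "xpow t \<equiv> Poly_Mapping.single t 1"

abbreviation homog :: "nat \<Rightarrow> ('n::finite, 'k::field) mpoly set" where
  "homog n \<equiv> {f. homogeneous_of_degree n f}"

section \<open>Ideals and cosets of the polynomial ring\<close>

lemma mpoly_ring_simps:
  "carrier mpoly_ring = UNIV" "x \<otimes>\<^bsub>mpoly_ring\<^esub> y = x * y"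
  "x \<oplus>\<^bsub>mpoly_ring\<^esub> y = x + y" "\<zero>\<^bsub>mpoly_ring\<^esub> = 0" "\<one>\<^bsub>mpoly_ring\<^esub> = 1"
  by (simp_all add: ring_of_type_algebra_def)

lemma cring_mpoly_ring: "cring mpoly_ring"
  by (rule cring_from_type_algebra)

lemma ideal_iff_subspace: "ideal I mpoly_ring \<longleftrightarrow> R.subspace I"
proof
  assume I: "ideal I mpoly_ring"
  have "0 \<in> I" 
    using additive_subgroup.zero_closed[OF ideal.axioms(1)[OF I]] by (simp add: mpoly_ring_simps)
  moreover have "x + y \<in> I" if "x \<in> I" "y \<in> I" for x y
    using additive_subgroup.a_closed[OF ideal.axioms(1)[OF I] that] by (simp add: mpoly_ring_simps)
  moreover have "c * x \<in> I" if "x \<in> I" for c x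
    using ideal.I_l_closed[OF I that] by (simp add: mpoly_ring_simps)
  ultimately show "R.subspace I" unfolding R.subspace_def by blast
next
  assume I: "R.subspace I"
  interpret cring mpoly_ring by (rule cring_mpoly_ring)
  have neg: "\<ominus>\<^bsub>mpoly_ring\<^esub> a = - a" for a
    by (rule minus_equality) (auto simp: mpoly_ring_simps)
  show "ideal I mpoly_ring"
  proof (rule idealI)
    show "subgroup I (add_monoid mpoly_ring)"
    proof (rule group.subgroupI)
      show "Group.group (add_monoid mpoly_ring)" by (rule a_group)
      show "inv\<^bsub>add_monoid mpoly_ring\<^esub> a \<in> I" if "a \<in> I" for a
        using that I by (fold a_inv_def) (simp add: neg R.subspace_neg)
      show "I \<noteq> {}" using I R.subspace_0 by blast
    qed (use I in \<open>auto simp: mpoly_ring_simps R.subspace_add\<close>)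
    show "x \<otimes>\<^bsub>mpoly_ring\<^esub> a \<in> I" if "a \<in> I" for a x
      using R.subspace_scale[OF I that] by (simp add: mpoly_ring_simps)
    then show "a \<otimes>\<^bsub>mpoly_ring\<^esub> x \<in> I" if "a \<in> I" for a x
      using that by (simp add: mpoly_ring_simps mult.commute)
  qed (rule ring_axioms)
qed

lemma genideal_eq_span: "genideal mpoly_ring S = R.span S"
proof -
  interpret cring mpoly_ring by (rule cring_mpoly_ring)
  show ?thesis
  proof
    show "genideal mpoly_ring S \<subseteq> R.span S"
      by (rule genideal_minimal) (auto simp: ideal_iff_subspace R.span_superset)
    show "R.span S \<subseteq> genideal mpoly_ring S"
      using genideal_ideal[of S] genideal_self[of S]
      by (intro R.span_minimal) (auto simp: ideal_iff_subspace mpoly_ring_simps)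
  qed
qed

lemma rcos_mem_iff:
  assumes "R.subspace I"
  shows "I +>\<^bsub>mpoly_ring\<^esub> f = I +>\<^bsub>mpoly_ring\<^esub> g \<longleftrightarrow> f - g \<in> I"
proof -
  have "I +>\<^bsub>mpoly_ring\<^esub> f = (\<lambda>h. h + f) ` I" for f
    by (auto simp: a_r_coset_def r_coset_def mpoly_ring_simps)
  then have eq: "I +>\<^bsub>mpoly_ring\<^esub> f = {h. h - f \<in> I}" for f
    by (auto simp: image_iff) (metis diff_add_cancel)
  show ?thesis
  proof
    assume "I +>\<^bsub>mpoly_ring\<^esub> f = I +>\<^bsub>mpoly_ring\<^esub> g"
    moreover have "f \<in> {h. h - f \<in> I}" using assms by (simp add: R.subspace_0)
    ultimately show "f - g \<in> I" unfolding eq by blast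
  next
    assume fg: "f - g \<in> I"
    have "h - f \<in> I \<longleftrightarrow> h - g \<in> I" for h
      using R.subspace_add[OF assms fg, of "h - f"] R.subspace_diff[OF assms _ fg, of "h - g"]
      by (auto simp: algebra_simps)
    then show "I +>\<^bsub>mpoly_ring\<^esub> f = I +>\<^bsub>mpoly_ring\<^esub> g" unfolding eq by blast
  qed
qed

text \<open>An ideal \<open>J\<close> above \<open>I\<close> is recovered from its image in the
  quotient, because equal cosets differ by an element of \<open>I \<subseteq> J\<close>.\<close>

lemma rcos_image_subset_iff:
  assumes "R.subspace I" "R.subspace J" "I \<subseteq> J"
  shows "(+>\<^bsub>mpoly_ring\<^esub>) I ` F \<subseteq> (+>\<^bsub>mpoly_ring\<^esub>) I ` J \<longleftrightarrow> F \<subseteq> J"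
proof
  assume sub: "(+>\<^bsub>mpoly_ring\<^esub>) I ` F \<subseteq> (+>\<^bsub>mpoly_ring\<^esub>) I ` J"
  show "F \<subseteq> J"
  proof
    fix f assume "f \<in> F"
    then obtain g where "g \<in> J" "I +>\<^bsub>mpoly_ring\<^esub> f = I +>\<^bsub>mpoly_ring\<^esub> g"
      using sub by blast
    then have "(f - g) + g \<in> J"
      using assms by (metis R.subspace_add rcos_mem_iff subsetD)
    then show "f \<in> J" by simp
  qed
qed auto

text \<open>Both inclusions come from minimality: the image of an ideal under the surjective
  projection is an ideal, and the preimage of an ideal is an ideal that contains
  \<open>I\<close>.\<close>

lemma genideal_quotient:
  assumes "R.subspace I"
  shows "genideal (mpoly_ring Quot I) ((+>\<^bsub>mpoly_ring\<^esub>) I ` L) = (+>\<^bsub>mpoly_ring\<^esub>) I ` R.span (I \<union> L)"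
proof -
  let ?\<pi> = "(+>\<^bsub>mpoly_ring\<^esub>) I" and ?A = "mpoly_ring Quot I"
  interpret I: ideal I mpoly_ring using assms by (simp add: ideal_iff_subspace)
  interpret h: ring_hom_ring mpoly_ring ?A ?\<pi> by (rule I.rcos_ring_hom_ring)
  have surj: "carrier ?A = range ?\<pi>"
    by (auto simp: FactRing_def A_RCOSETS_def' mpoly_ring_simps)
  have add: "?\<pi> (f + g) = ?\<pi> f \<oplus>\<^bsub>?A\<^esub> ?\<pi> g" for f g
    using h.hom_add[of f g] by (simp add: mpoly_ring_simps)
  have mult: "?\<pi> (f * g) = ?\<pi> f \<otimes>\<^bsub>?A\<^esub> ?\<pi> g" for f g
    using h.hom_mult[of f g] by (simp add: mpoly_ring_simps)
  have zero: "?\<pi> 0 = \<zero>\<^bsub>?A\<^esub>" using h.hom_zero by (simp add: mpoly_ring_simps)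
  have neg: "?\<pi> (- f) = \<ominus>\<^bsub>?A\<^esub> ?\<pi> f" for f
  proof (rule h.S.minus_equality[symmetric])
    show "?\<pi> (- f) \<oplus>\<^bsub>?A\<^esub> ?\<pi> f = \<zero>\<^bsub>?A\<^esub>" by (simp flip: add zero)
  qed (auto simp: surj)
  let ?J = "R.span (I \<union> L)"
  have "ideal (?\<pi> ` ?J) ?A"
  proof (rule idealI)
    show "ring ?A" by (rule h.S.ring_axioms)
    show "subgroup (?\<pi> ` ?J) (add_monoid ?A)"
    proof (rule group.subgroupI)
      show "Group.group (add_monoid ?A)" by (rule h.S.a_group)
      show "?\<pi> ` ?J \<noteq> {}" using R.span_zero by blast
      show "inv\<^bsub>add_monoid ?A\<^esub> a \<in> ?\<pi> ` ?J" if "a \<in> ?\<pi> ` ?J" for a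
        using that by (fold a_inv_def) (auto simp flip: neg intro: R.span_neg)
      show "a \<otimes>\<^bsub>add_monoid ?A\<^esub> b \<in> ?\<pi> ` ?J" if "a \<in> ?\<pi> ` ?J" "b \<in> ?\<pi> ` ?J" for a b
        using that by (auto simp flip: add intro: R.span_add)
    qed (auto simp: surj)
    show "x \<otimes>\<^bsub>?A\<^esub> a \<in> ?\<pi> ` ?J" if "a \<in> ?\<pi> ` ?J" "x \<in> carrier ?A" for a x
      using that by (auto simp: surj simp flip: mult intro: R.span_scale)
    show "a \<otimes>\<^bsub>?A\<^esub> x \<in> ?\<pi> ` ?J" if "a \<in> ?\<pi> ` ?J" "x \<in> carrier ?A" for a x
    proof -
      obtain f g where "a = ?\<pi> f" "x = ?\<pi> g" "f \<in> ?J" using \<open>a \<in> ?\<pi> ` ?J\<close> \<open>x \<in> carrier ?A\<close> surj by auto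
      then show ?thesis using R.span_scale[of f "I \<union> L" g] by (auto simp: mult.commute[of g f] simp flip: mult)
    qed
  qed
  then have 1: "genideal ?A (?\<pi> ` L) \<subseteq> ?\<pi> ` ?J"
    by (rule h.S.genideal_minimal) (auto intro: R.span_base)
  have L: "?\<pi> ` L \<subseteq> carrier ?A" by (auto simp: surj)
  let ?G = "genideal ?A (?\<pi> ` L)"
  interpret G: ideal ?G ?A by (rule h.S.genideal_ideal[OF L])
  have "R.subspace {f. ?\<pi> f \<in> ?G}"
    unfolding R.subspace_def
    by (auto simp: zero add mult surj intro!: G.zero_closed G.a_closed G.I_l_closed)
  moreover have "f \<in> I \<Longrightarrow> ?\<pi> f \<in> ?G" for f
    using rcos_mem_iff[OF assms, of f 0] zero G.zero_closed by simp
  then have "I \<union> L \<subseteq> {f. ?\<pi> f \<in> ?G}"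
    using h.S.genideal_self[OF L] by auto
  ultimately have "?J \<subseteq> {f. ?\<pi> f \<in> ?G}" by (rule R.span_minimal[rotated])
  with 1 show ?thesis by auto
qed

section \<open>Reductions of the quotient as sets of linear forms\<close>

definition reduces :: "('n::finite, 'k::field) mpoly set \<Rightarrow> ('n, 'k) mpoly set \<Rightarrow> bool" where
  "reduces I L \<longleftrightarrow> L \<subseteq> homog 1 \<and> (\<exists>N. \<forall>n\<ge>N. homog n \<subseteq> R.span (I \<union> L))"

text \<open>The ideal \<open>R.span (I \<union> L)\<close> is the preimage of the one that
  \<open>L\<close> generates in the quotient. Minimality compares these ideals and not the sets
  \<open>L\<close>, since different sets of forms can generate the same reduction.\<close>

definition minimally_reduces :: "('n::finite, 'k::field) mpoly set \<Rightarrow> ('n, 'k) mpoly set \<Rightarrow> bool" where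
  "minimally_reduces I L \<longleftrightarrow>
     reduces I L \<and> \<not> (\<exists>L'. reduces I L' \<and> R.span (I \<union> L') \<subset> R.span (I \<union> L))"

lemma quotient_grading_eq: "quotient_grading I n = (+>\<^bsub>mpoly_ring\<^esub>) I ` homog n"
  by (auto simp: quotient_grading_def)

lemma quotient_component_iff:
  assumes "R.subspace I"
  shows "(+>\<^bsub>mpoly_ring\<^esub>) I ` R.span (I \<union> L) \<inter> quotient_grading I n = quotient_grading I n
    \<longleftrightarrow> homog n \<subseteq> R.span (I \<union> L)"
  using rcos_image_subset_iff[OF assms R.subspace_span[of "I \<union> L"], of "homog n"] R.span_superset[of "I \<union> L"]
  unfolding quotient_grading_eq by blast

lemma is_reduction_quotient_iff:
  assumes "R.subspace I"
  shows "is_reduction (mpoly_ring Quot I) (quotient_grading I) Q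
    \<longleftrightarrow> (\<exists>L. reduces I L \<and> Q = (+>\<^bsub>mpoly_ring\<^esub>) I ` R.span (I \<union> L))"
proof -
  have "(\<exists>S. S \<subseteq> quotient_grading I 1 \<and> Q = genideal (mpoly_ring Quot I) S)
    \<longleftrightarrow> (\<exists>L\<subseteq>homog 1. Q = (+>\<^bsub>mpoly_ring\<^esub>) I ` R.span (I \<union> L))"
    unfolding quotient_grading_eq subset_image_iff by (metis genideal_quotient[OF assms])
  then show ?thesis
    unfolding is_reduction_def reduces_def using quotient_component_iff[OF assms] by metis
qed

lemma is_minimal_reduction_quotient_iff:
  assumes "R.subspace I"
  shows "is_minimal_reduction (mpoly_ring Quot I) (quotient_grading I) Q
    \<longleftrightarrow> (\<exists>L. minimally_reduces I L \<and> Q = (+>\<^bsub>mpoly_ring\<^esub>) I ` R.span (I \<union> L))"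
proof -
  have sub: "(+>\<^bsub>mpoly_ring\<^esub>) I ` R.span (I \<union> L) \<subseteq> (+>\<^bsub>mpoly_ring\<^esub>) I ` R.span (I \<union> L')
    \<longleftrightarrow> R.span (I \<union> L) \<subseteq> R.span (I \<union> L')" for L L'
    by (rule rcos_image_subset_iff[OF assms]) (auto intro: R.span_base)
  then have psub: "(+>\<^bsub>mpoly_ring\<^esub>) I ` R.span (I \<union> L) \<subset> (+>\<^bsub>mpoly_ring\<^esub>) I ` R.span (I \<union> L')
    \<longleftrightarrow> R.span (I \<union> L) \<subset> R.span (I \<union> L')" for L L'
    by (simp add: less_le_not_le)
  have eq: "(\<exists>Q'. is_reduction (mpoly_ring Quot I) (quotient_grading I) Q'
      \<and> Q' \<subset> (+>\<^bsub>mpoly_ring\<^esub>) I ` R.span (I \<union> L))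
    \<longleftrightarrow> (\<exists>L'. reduces I L' \<and> R.span (I \<union> L') \<subset> R.span (I \<union> L))" for L
    unfolding is_reduction_quotient_iff[OF assms] psub[symmetric] by auto
  have "is_minimal_reduction (mpoly_ring Quot I) (quotient_grading I) Q \<longleftrightarrow>
    (\<exists>L. reduces I L \<and> Q = (+>\<^bsub>mpoly_ring\<^esub>) I ` R.span (I \<union> L) \<and>
      \<not> (\<exists>Q'. is_reduction (mpoly_ring Quot I) (quotient_grading I) Q'
        \<and> Q' \<subset> (+>\<^bsub>mpoly_ring\<^esub>) I ` R.span (I \<union> L)))"
    unfolding is_minimal_reduction_def is_reduction_quotient_iff[OF assms, of Q] by blast
  then show ?thesis
    unfolding eq minimally_reduces_def by (simp only: conj_ac)
qed

text \<open>Components and minimality both pass through the ideal correspondence, so what remains to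
  be compared are ideals of the polynomial ring and sets of linear forms.\<close>

lemma reduction_number_quotient:
  assumes "R.subspace I"
  shows "reduction_number (mpoly_ring Quot I) (quotient_grading I)
    = Inf {LEAST n. homog (n + 1) \<subseteq> R.span (I \<union> L) | L. minimally_reduces I L}"
proof -
  have *: "reduction_number_wrt (mpoly_ring Quot I) (quotient_grading I) ((+>\<^bsub>mpoly_ring\<^esub>) I ` R.span (I \<union> L))
    = (LEAST n. homog (n + 1) \<subseteq> R.span (I \<union> L))" for L
    unfolding reduction_number_wrt_def quotient_component_iff[OF assms] ..
  have "(\<exists>Q. m = reduction_number_wrt (mpoly_ring Quot I) (quotient_grading I) Q \<and>
      (\<exists>L. minimally_reduces I L \<and> Q = (+>\<^bsub>mpoly_ring\<^esub>) I ` R.span (I \<union> L)))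
    \<longleftrightarrow> (\<exists>L. m = (LEAST n. homog (n + 1) \<subseteq> R.span (I \<union> L)) \<and> minimally_reduces I L)" for m
    unfolding *[symmetric] by blast
  then show ?thesis
    unfolding reduction_number_def is_minimal_reduction_quotient_iff[OF assms] by simp
qed

section \<open>Homogeneous parts and independence modulo an ideal\<close>

lemma subspace_K: "R.subspace I \<Longrightarrow> K.subspace I"
  by (auto simp: K.subspace_def R.subspace_def kscale_def)

lemma kscale_mult_left: "kscale c f * g = kscale c (f * g)"
  by (simp add: kscale_def mult.assoc)

lemma kscale_mult_right: "f * kscale c g = kscale c (f * g)"
  by (simp add: kscale_def mult_ac)

lemma mpoly_eq_sum_monomials:
  "f = (\<Sum>t\<in>Poly_Mapping.keys f. kscale (Poly_Mapping.lookup f t) (xpow t))"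
proof (rule poly_mapping_eqI)
  fix s
  have "(\<Sum>t\<in>Poly_Mapping.keys f. Poly_Mapping.lookup f t * Poly_Mapping.lookup (xpow t) s)
    = (\<Sum>t\<in>Poly_Mapping.keys f. if t = s then Poly_Mapping.lookup f t else 0)"
    by (intro sum.cong) (auto simp: lookup_single)
  then show "Poly_Mapping.lookup f s
    = Poly_Mapping.lookup (\<Sum>t\<in>Poly_Mapping.keys f. kscale (Poly_Mapping.lookup f t) (xpow t)) s"
    by (auto simp: lookup_sum in_keys_iff)
qed

lemma mpoly_in_span_monomials:
  assumes "\<And>t. t \<in> Poly_Mapping.keys f \<Longrightarrow> xpow t \<in> K.span S"
  shows "f \<in> K.span S"
  by (subst mpoly_eq_sum_monomials) (intro K.span_sum K.span_scale assms)

section \<open>Total degree and forms\<close>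

lemma total_degree_add: "total_degree (s + t) = total_degree s + total_degree t"
  by (simp add: total_degree_def lookup_add sum.distrib)

lemma total_degree_zero [simp]: "total_degree 0 = 0"
  by (simp add: total_degree_def)

lemma total_degree_eq_0_iff [simp]: "total_degree t = 0 \<longleftrightarrow> t = 0"
  by (auto simp: total_degree_def intro: poly_mapping_eqI)

lemma finite_total_degree_le: "finite {t :: ('n::finite) monomial. total_degree t \<le> n}"
proof -
  have "Poly_Mapping.lookup ` {t :: 'n monomial. total_degree t \<le> n} \<subseteq> PiE UNIV (\<lambda>_. {..n})"
  proof (clarsimp simp: total_degree_def PiE_iff)
    fix t :: "'n monomial" and i
    assume "(\<Sum>i\<in>UNIV. Poly_Mapping.lookup t i) \<le> n"
    then show "Poly_Mapping.lookup t i \<le> n"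
      using member_le_sum[of i UNIV "Poly_Mapping.lookup t"] by simp
  qed
  then have "finite (Poly_Mapping.lookup ` {t :: 'n monomial. total_degree t \<le> n})"
    by (rule finite_subset) (auto intro: finite_PiE)
  then show ?thesis
    by (rule finite_imageD) (auto intro: inj_onI poly_mapping_eqI)
qed

lemma subspace_homog: "K.subspace (homog n)"
  unfolding K.subspace_def homogeneous_of_degree_def
  by (auto simp: in_keys_iff lookup_add)

lemma xpow_homog: "xpow t \<in> homog (total_degree t)"
  by (simp add: homogeneous_of_degree_def)

lemma homog_mult: "f \<in> homog a \<Longrightarrow> g \<in> homog b \<Longrightarrow> f * g \<in> homog (a + b)"
  using keys_mult[of f g] by (fastforce simp: homogeneous_of_degree_def total_degree_add)

lemma homog_prod:
  assumes "finite Z" "\<And>z. z \<in> Z \<Longrightarrow> v z \<in> homog (d z)"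
  shows "(\<Prod>z\<in>Z. v z) \<in> homog (\<Sum>z\<in>Z. d z)"
  using assms
proof (induction Z rule: finite_induct)
  case empty
  show ?case by (simp add: homogeneous_of_degree_def)
next
  case (insert x F)
  then show ?case using homog_mult[of "v x" "d x"] by simp
qed

lemma homog_power: "f \<in> homog a \<Longrightarrow> f ^ n \<in> homog (n * a)"
proof (induction n)
  case 0
  show ?case by (simp add: homogeneous_of_degree_def)
next
  case (Suc n)
  then show ?case using homog_mult[of f a "f ^ n" "n * a"] by simp
qed

section \<open>Homogeneous components and graded ideals\<close>

definition hom_part :: "nat \<Rightarrow> ('n::finite, 'k::field) mpoly \<Rightarrow> ('n, 'k) mpoly" where
  "hom_part n f = Poly_Mapping.mapp (\<lambda>t c. c when total_degree t = n) f"

lemma lookup_hom_part: "Poly_Mapping.lookup (hom_part n f) t = (Poly_Mapping.lookup f t when total_degree t = n)"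
  by (auto simp: hom_part_def lookup_mapp when_def in_keys_iff)

lemma hom_part_zero [simp]: "hom_part n 0 = 0"
  by (rule poly_mapping_eqI) (simp add: lookup_hom_part)

lemma hom_part_add: "hom_part n (f + g) = hom_part n f + hom_part n g"
  by (rule poly_mapping_eqI) (simp add: lookup_hom_part lookup_add when_add_distrib)

lemma hom_part_sum: "hom_part n (\<Sum>a\<in>A. f a) = (\<Sum>a\<in>A. hom_part n (f a))"
  by (induction A rule: infinite_finite_induct) (auto simp: hom_part_add)

lemma hom_part_kscale: "hom_part n (kscale c f) = kscale c (hom_part n f)"
  by (rule poly_mapping_eqI) (simp add: lookup_hom_part when_def)

lemma hom_part_homog [simp]: "hom_part n f \<in> homog n"
  by (auto simp: homogeneous_of_degree_def in_keys_iff lookup_hom_part when_def split: if_splits)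

lemma hom_part_of_homog: "f \<in> homog m \<Longrightarrow> hom_part n f = (if m = n then f else 0)"
  by (rule poly_mapping_eqI)
    (auto simp: homogeneous_of_degree_def lookup_hom_part when_def in_keys_iff)

text \<open>Multiplication by a form of degree \<open>e\<close> shifts degrees by \<open>e\<close>;
  this is checked on monomials and extended linearly in \<open>g\<close>.\<close>

lemma hom_part_mult:
  fixes l :: "('n::finite, 'k::field) mpoly"
  assumes "l \<in> homog e"
  shows "hom_part n (g * l) = (if e \<le> n then hom_part (n - e) g * l else 0)"
proof -
  have *: "hom_part n (xpow t * l) = (if e \<le> n then hom_part (n - e) (xpow t) * l else 0)" for t
  proof -
    have xt: "(xpow t :: ('n, 'k) mpoly) \<in> homog (total_degree t)" by (rule xpow_homog)
    show ?thesis
      using hom_part_of_homog[OF homog_mult[OF xt assms], of n] hom_part_of_homog[OF xt, of "n - e"] by auto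
  qed
  have "hom_part n (g * l)
    = (\<Sum>t\<in>Poly_Mapping.keys g. kscale (Poly_Mapping.lookup g t) (hom_part n (xpow t * l)))"
    by (subst mpoly_eq_sum_monomials[of g])
      (simp add: sum_distrib_right hom_part_sum kscale_mult_left hom_part_kscale)
  also have "\<dots> = (if e \<le> n then
      hom_part (n - e) (\<Sum>t\<in>Poly_Mapping.keys g. kscale (Poly_Mapping.lookup g t) (xpow t)) * l else 0)"
    by (simp add: * sum_distrib_right hom_part_sum kscale_mult_left hom_part_kscale)
  finally show ?thesis by (simp flip: mpoly_eq_sum_monomials)
qed

text \<open>Homogeneity of an ideal as closure under taking components; \<open>graded_span\<close>
  obtains it from homogeneous generators.\<close>

definition graded :: "('n::finite, 'k::field) mpoly set \<Rightarrow> bool" where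
  "graded I \<longleftrightarrow> (\<forall>f\<in>I. \<forall>n. hom_part n f \<in> I)"

lemma graded_span:
  assumes "\<And>f. f \<in> S \<Longrightarrow> \<exists>n. f \<in> homog n"
  shows "graded (R.span S)"
  unfolding graded_def
proof (intro ballI allI)
  fix f n assume "f \<in> R.span S"
  then show "hom_part n f \<in> R.span S"
  proof (induction rule: R.span_induct_alt)
    case base
    show ?case by (simp add: R.span_zero)
  next
    case (step c x y)
    then obtain e where "x \<in> homog e" using assms by blast
    with step show ?case
      by (auto simp: hom_part_add hom_part_mult intro: R.span_add R.span_scale R.span_base R.span_zero)
  qed
qed

text \<open>In a fixed degree, membership in an ideal becomes linear algebra over k: since the forms
  in \<open>L\<close> have degree 1, their coefficients may be taken to be monomials of degree
  \<open>n\<close>.\<close>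

lemma hom_part_span_linear:
  assumes I: "R.subspace I" "graded I" and L: "L \<subseteq> homog 1" and f: "f \<in> R.span (I \<union> L)"
  shows "hom_part (Suc n) f \<in> K.span (I \<union> {xpow t * l | t l. total_degree t = n \<and> l \<in> L})"
    (is "_ \<in> K.span ?B")
  using f
proof (induction rule: R.span_induct_alt)
  case base
  show ?case by (simp add: K.span_zero)
next
  case (step c x y)
  have "hom_part (Suc n) (c * x) \<in> K.span ?B"
  proof (cases "x \<in> I")
    case True
    then have "hom_part (Suc n) (c * x) \<in> I"
      using I by (auto simp: graded_def intro: R.subspace_scale)
    then show ?thesis by (simp add: K.span_base)
  next
    case False
    then have x: "x \<in> L" using step by blast
    \<comment> \<open>As \<open>x\<close> is linear, only the degree \<open>n\<close> part of the
      coefficient \<open>c\<close> contributes in degree \<open>n + 1\<close>.\<close>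
    let ?g = "hom_part n c"
    have "?g * x = (\<Sum>t\<in>Poly_Mapping.keys ?g. kscale (Poly_Mapping.lookup ?g t) (xpow t)) * x"
      by (simp flip: mpoly_eq_sum_monomials)
    also have "\<dots> = (\<Sum>t\<in>Poly_Mapping.keys ?g. kscale (Poly_Mapping.lookup ?g t) (xpow t * x))"
      by (simp add: sum_distrib_right kscale_mult_left)
    also have "\<dots> \<in> K.span ?B"
    proof (intro K.span_sum K.span_scale K.span_base)
      fix t assume "t \<in> Poly_Mapping.keys ?g"
      then have "total_degree t = n"
        using hom_part_homog[of n c] by (auto simp: homogeneous_of_degree_def)
      then show "xpow t * x \<in> ?B" using x by blast
    qed
    finally show ?thesis using L x hom_part_mult[of x 1 "Suc n" c] by auto
  qed
  with step show ?case by (simp add: hom_part_add K.span_add)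
qed

lemma homog_in_span_linear:
  assumes I: "R.subspace I" "graded I" and L: "L \<subseteq> homog 1"
    and f: "f \<in> R.span (I \<union> L)" "f \<in> homog (Suc n)"
  shows "f \<in> K.span (I \<union> {xpow t * l | t l. total_degree t = n \<and> l \<in> L})"
  using hom_part_span_linear[OF I L f(1), of n] hom_part_of_homog[OF f(2), of "Suc n"] by simp

text \<open>The case of degree 1: the only monomial coefficient of degree 0 is 1.\<close>

lemma linear_form_in_span:
  assumes "R.subspace I" "graded I" "L \<subseteq> homog 1" "f \<in> R.span (I \<union> L)" "f \<in> homog 1"
  shows "f \<in> K.span (I \<union> L)"
proof -
  have "{xpow t * l | t l. total_degree t = 0 \<and> l \<in> L} = L" by auto
  then show ?thesis using homog_in_span_linear[of I L f 0] assms by simp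
qed

section \<open>Linear algebra modulo a subspace\<close>

definition indep_mod :: "('n::finite, 'k::field) mpoly set \<Rightarrow> ('a \<Rightarrow> ('n, 'k) mpoly) \<Rightarrow> 'a set \<Rightarrow> bool" where
  "indep_mod I v A \<longleftrightarrow> (\<forall>c. (\<Sum>a\<in>A. kscale (c a) (v a)) \<in> I \<longrightarrow> (\<forall>a\<in>A. c a = 0))"

lemma indep_modD: "indep_mod I v A \<Longrightarrow> (\<Sum>a\<in>A. kscale (c a) (v a)) \<in> I \<Longrightarrow> a \<in> A \<Longrightarrow> c a = 0"
  by (auto simp: indep_mod_def)

text \<open>Steinitz exchange in the quotient by \<open>I\<close>: each \<open>v a\<close> is
  congruent modulo \<open>I\<close> to some \<open>w a\<close> in the span of \<open>B\<close>, and
  the \<open>w a\<close> are then independent in the ordinary sense.\<close>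

lemma indep_mod_card_le:
  assumes I: "K.subspace I" and fin: "finite A" "finite B" and ind: "indep_mod I v A"
    and v: "\<And>a. a \<in> A \<Longrightarrow> v a \<in> K.span (I \<union> B)"
  shows "card A \<le> card B"
proof -
  have "\<exists>w. w \<in> K.span B \<and> v a - w \<in> I" if a: "a \<in> A" for a
  proof -
    obtain x y where "v a = x + y" "x \<in> K.span I" "y \<in> K.span B"
      using v[OF a] unfolding K.span_Un by blast
    then show ?thesis using I by (auto simp: K.span_eq_iff[THEN iffD2])
  qed
  then obtain w where w: "\<And>a. a \<in> A \<Longrightarrow> w a \<in> K.span B" "\<And>a. a \<in> A \<Longrightarrow> v a - w a \<in> I"
    by metis
  have diff: "(\<Sum>a\<in>A. kscale (c a) (v a)) - (\<Sum>a\<in>A. kscale (c a) (w a)) \<in> I" for c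
    unfolding sum_subtractf[symmetric] K.scale_right_diff_distrib[symmetric]
    by (intro K.subspace_sum[OF I] K.subspace_scale[OF I] w)
  have zero: "c a = 0" if "(\<Sum>a\<in>A. kscale (c a) (w a)) = 0" "a \<in> A" for c a
    using diff[of c] that by (intro indep_modD[OF ind, of c]) auto
  have inj: "inj_on w A"
  proof (rule inj_onI, rule ccontr)
    fix a b assume ab: "a \<in> A" "b \<in> A" "w a = w b" "a \<noteq> b"
    \<comment> \<open>A coincidence \<open>w a = w b\<close> would give a relation with coefficients
      1 and -1.\<close>
    let ?c = "\<lambda>x. if x = a then 1 else if x = b then - 1 else 0 :: 'a"
    have "(\<Sum>x\<in>A. kscale (?c x) (w x)) = (\<Sum>x\<in>{a, b}. kscale (?c x) (w x))"
      by (rule sum.mono_neutral_right) (use fin ab in auto)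
    then have "(\<Sum>x\<in>A. kscale (?c x) (w x)) = 0"
      using ab by simp
    from zero[OF this ab(1)] show False by simp
  qed
  have "K.independent (w ` A)"
  proof (rule K.independent_if_scalars_zero)
    fix f x assume "(\<Sum>x\<in>w ` A. kscale (f x) x) = 0" "x \<in> w ` A"
    then show "f x = 0" using zero[of "f \<circ> w"] inj by (auto simp: sum.reindex)
  qed (use fin in simp)
  then have "card (w ` A) \<le> card B"
    using K.independent_span_bound[OF fin(2)] w(1) by blast
  then show ?thesis by (simp add: card_image inj)
qed

lemma indep_mod_insert:
  assumes fin: "finite A" and ind: "indep_mod I v A" and a: "v a \<notin> K.span (I \<union> v ` A)"
  shows "indep_mod I v (insert a A)"
  unfolding indep_mod_def
proof (intro allI impI)
  fix c assume c: "(\<Sum>b\<in>insert a A. kscale (c b) (v b)) \<in> I"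
  have "a \<notin> A" using a by (auto intro: K.span_base)
  with c fin have sum: "kscale (c a) (v a) + (\<Sum>b\<in>A. kscale (c b) (v b)) \<in> I" by simp
  have "c a = 0"
  proof (rule ccontr)
    assume "c a \<noteq> 0"
    have "kscale (c a) (v a) + (\<Sum>b\<in>A. kscale (c b) (v b)) \<in> K.span (I \<union> v ` A)"
      using sum by (simp add: K.span_base)
    moreover have "(\<Sum>b\<in>A. kscale (c b) (v b)) \<in> K.span (I \<union> v ` A)"
      by (intro K.span_sum K.span_scale K.span_base) simp
    ultimately have "kscale (c a) (v a) \<in> K.span (I \<union> v ` A)"
      using K.span_diff by fastforce
    then have "kscale (inverse (c a)) (kscale (c a) (v a)) \<in> K.span (I \<union> v ` A)"
      by (rule K.span_scale)
    with \<open>c a \<noteq> 0\<close> a show False by simp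
  qed
  with sum have "(\<Sum>b\<in>A. kscale (c b) (v b)) \<in> I" by simp
  with \<open>c a = 0\<close> show "\<forall>b\<in>insert a A. c b = 0" using indep_modD[OF ind] by blast
qed

text \<open>The last assumption says that the polynomial with terms \<open>c s\<close> and exponents
  \<open>E s\<close> has a nonzero coefficient at the exponent \<open>m\<close>. Over an infinite
  field it has a non-root, found one variable at a time, and each coordinate can moreover be kept
  away from 0.\<close>

lemma monomial_combination_nonzero:
  fixes c :: "'s \<Rightarrow> 'k::field" and E :: "'s \<Rightarrow> 'v \<Rightarrow> nat"
  assumes inf: "infinite (UNIV :: 'k set)" and "finite V" and "finite S"
    and "(\<Sum>s | s \<in> S \<and> (\<forall>x\<in>V. E s x = m x). c s) \<noteq> 0"
  shows "\<exists>p. (\<forall>x\<in>V. p x \<noteq> 0) \<and> (\<Sum>s\<in>S. c s * (\<Prod>x\<in>V. p x ^ E s x)) \<noteq> 0"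
  using assms(2-4)
proof (induction V arbitrary: S rule: finite_induct)
  case empty
  then show ?case by simp
next
  case (insert x V)
  let ?S = "{s \<in> S. E s x = m x}"
  have "{s. s \<in> ?S \<and> (\<forall>y\<in>V. E s y = m y)} = {s. s \<in> S \<and> (\<forall>y\<in>insert x V. E s y = m y)}"
    by auto
  then have "(\<Sum>s | s \<in> ?S \<and> (\<forall>y\<in>V. E s y = m y). c s) \<noteq> 0"
    using insert.prems(2) by simp
  then obtain p where p: "\<And>y. y \<in> V \<Longrightarrow> p y \<noteq> 0" "(\<Sum>s\<in>?S. c s * (\<Prod>y\<in>V. p y ^ E s y)) \<noteq> 0"
    using insert.IH[of ?S] insert.prems(1) by auto
  \<comment> \<open>All variables but \<open>x\<close> are substituted by \<open>p\<close>; the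
    coefficient of \<open>q\<close> at \<open>m x\<close> is nonzero by the choice of
    \<open>p\<close>.\<close>
  define q where "q = (\<Sum>s\<in>S. Polynomial.monom (c s * (\<Prod>y\<in>V. p y ^ E s y)) (E s x))"
  have "Polynomial.coeff q (m x) = (\<Sum>s\<in>S. if E s x = m x then c s * (\<Prod>y\<in>V. p y ^ E s y) else 0)"
    by (auto simp: q_def Polynomial.coeff_sum intro!: sum.cong)
  also have "\<dots> \<noteq> 0" using p(2) insert.prems(1) by (simp flip: sum.inter_filter)
  finally have "q \<noteq> 0" by auto
  then have "finite ({y. poly q y = 0} \<union> {0})" by (simp add: poly_roots_finite)
  then obtain y where y: "poly q y \<noteq> 0" "y \<noteq> 0"
    using inf ex_new_if_finite[of "{y. poly q y = 0} \<union> {0}"] by auto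
  let ?p = "p(x := y)"
  have "(\<Prod>z\<in>V. ?p z ^ E s z) = (\<Prod>z\<in>V. p z ^ E s z)" for s
    using insert.hyps by (intro prod.cong) auto
  then have "(\<Sum>s\<in>S. c s * (\<Prod>z\<in>insert x V. ?p z ^ E s z)) = poly q y"
    using insert.hyps by (simp add: q_def poly_sum poly_monom mult_ac)
  then show ?case using p(1) y by (intro exI[of _ ?p]) auto
qed

section \<open>Initial monomials\<close>

lemma lookup_xpow_mult: "Poly_Mapping.lookup (xpow s * f) (s + t) = Poly_Mapping.lookup f t"
proof -
  have "xpow s * f = (\<Sum>t\<in>Poly_Mapping.keys f. kscale (Poly_Mapping.lookup f t) (xpow (s + t)))"
  proof -
    have "xpow s * f = xpow s * (\<Sum>t\<in>Poly_Mapping.keys f. kscale (Poly_Mapping.lookup f t) (xpow t))"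
      by (simp flip: mpoly_eq_sum_monomials)
    then show ?thesis by (simp add: sum_distrib_left kscale_mult_right mult_single)
  qed
  then have "Poly_Mapping.lookup (xpow s * f) (s + t)
    = (\<Sum>u\<in>Poly_Mapping.keys f. if u = t then Poly_Mapping.lookup f u else 0)"
    by (simp only: lookup_sum lookup_kscale, intro sum.cong) (auto simp: lookup_single)
  then show ?thesis by (simp add: in_keys_iff)
qed

lemma keys_xpow_mult: "Poly_Mapping.keys (xpow s * f) = (+) s ` Poly_Mapping.keys f"
proof
  show "Poly_Mapping.keys (xpow s * f) \<subseteq> (+) s ` Poly_Mapping.keys f"
    using keys_mult[of "xpow s" f] by (auto split: if_splits)
  show "(+) s ` Poly_Mapping.keys f \<subseteq> Poly_Mapping.keys (xpow s * f)"
    by (auto simp: in_keys_iff lookup_xpow_mult)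
qed

section \<open>Term orders and greatest monomials\<close>

lemma term_order_antisym: "term_order ord \<Longrightarrow> (s, t) \<in> ord \<Longrightarrow> (t, s) \<in> ord \<Longrightarrow> s = t"
  unfolding term_order_def order_on_defs by (auto dest: antisymD)

lemma term_order_trans: "term_order ord \<Longrightarrow> (s, t) \<in> ord \<Longrightarrow> (t, u) \<in> ord \<Longrightarrow> (s, u) \<in> ord"
  unfolding term_order_def order_on_defs by (auto dest: transD)

lemma term_order_refl: "term_order ord \<Longrightarrow> (s, s) \<in> ord"
  unfolding term_order_def order_on_defs by (auto dest: refl_onD)

lemma term_order_total: "term_order ord \<Longrightarrow> (s, t) \<in> ord \<or> (t, s) \<in> ord"
  using term_order_refl[of ord s] unfolding term_order_def order_on_defs total_on_def
  by (cases "s = t") auto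

lemma term_order_add: "term_order ord \<Longrightarrow> (s, t) \<in> ord \<Longrightarrow> (s + u, t + u) \<in> ord"
  unfolding term_order_def by blast

text \<open>Addition is monotone and cancellative, so equality of the sums leaves no room for a
  strict inequality in any summand. This rigidity isolates the leading entries in
  \<open>det_rescaled_nonzero\<close>.\<close>

lemma term_order_sum_eq:
  assumes ord: "term_order ord" and "finite P" "\<And>i. i \<in> P \<Longrightarrow> (a i, b i) \<in> ord"
  shows "(sum a P, sum b P) \<in> ord \<and> (sum a P = sum b P \<longrightarrow> (\<forall>i\<in>P. a i = b i))"
  using assms(2,3)
proof (induction P rule: finite_induct)
  case empty
  then show ?case using term_order_refl[OF ord] by simp
next
  case (insert x F)
  have IH: "(sum a F, sum b F) \<in> ord" "sum a F = sum b F \<longrightarrow> (\<forall>i\<in>F. a i = b i)"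
    using insert.IH insert.prems by blast+
  have 1: "(a x + sum a F, b x + sum a F) \<in> ord"
    by (rule term_order_add[OF ord]) (simp add: insert.prems)
  have 2: "(b x + sum a F, b x + sum b F) \<in> ord"
    using term_order_add[OF ord IH(1), of "b x"] by (simp add: add.commute)
  have "\<forall>i\<in>insert x F. a i = b i" if eq: "a x + sum a F = b x + sum b F"
  proof -
    \<comment> \<open>The chain from \<open>a x + sum a F\<close> over \<open>b x + sum a F\<close>
      to \<open>b x + sum b F\<close> has equal ends, so it is constant.\<close>
    have "b x + sum a F = b x + sum b F"
      using term_order_antisym[OF ord 2] 1 eq by simp
    then have "sum a F = sum b F" by simp
    with eq IH(2) show ?thesis by simp
  qed
  then show ?case
    unfolding sum.insert[OF insert.hyps] using term_order_trans[OF ord 1 2] by blast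
qed

text \<open>The support is finite and nonempty and the order is total, so the \<open>THE\<close> in
  the definition does denote something.\<close>

lemma initial_monomial_greatest:
  assumes ord: "term_order ord" and "f \<noteq> 0"
  shows "initial_monomial ord f \<in> Poly_Mapping.keys f
    \<and> (\<forall>s\<in>Poly_Mapping.keys f. (s, initial_monomial ord f) \<in> ord)"
proof -
  have "\<exists>t\<in>A. \<forall>s\<in>A. (s, t) \<in> ord" if "finite A" "A \<noteq> {}" for A
    using that
  proof (induction A rule: finite_ne_induct)
    case (singleton x)
    then show ?case using term_order_refl[OF ord] by simp
  next
    case (insert x F)
    then obtain t where "t \<in> F" "\<forall>s\<in>F. (s, t) \<in> ord" by blast
    then show ?case
      using term_order_total[OF ord, of x t] term_order_trans[OF ord] term_order_refl[OF ord]
      by (metis insert_iff)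
  qed
  from this[of "Poly_Mapping.keys f"] assms(2)
  have "\<exists>t. t \<in> Poly_Mapping.keys f \<and> (\<forall>s\<in>Poly_Mapping.keys f. (s, t) \<in> ord)" by auto
  then have "\<exists>!t. t \<in> Poly_Mapping.keys f \<and> (\<forall>s\<in>Poly_Mapping.keys f. (s, t) \<in> ord)"
    using term_order_antisym[OF ord] by blast
  from theI'[OF this] show ?thesis unfolding initial_monomial_def .
qed

lemma initial_monomial_eqI:
  assumes "term_order ord" "t \<in> Poly_Mapping.keys f" "\<And>s. s \<in> Poly_Mapping.keys f \<Longrightarrow> (s, t) \<in> ord"
  shows "initial_monomial ord f = t"
proof -
  have "f \<noteq> 0" using assms(2) by auto
  from initial_monomial_greatest[OF assms(1) this] show ?thesis
    using assms(2,3) term_order_antisym[OF assms(1)] by blast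
qed

section \<open>Monomials of the initial ideal\<close>

definition initial_monomials ::
    "('n::finite) monomial rel \<Rightarrow> ('n, 'k::field) mpoly set \<Rightarrow> 'n monomial set" where
  "initial_monomials ord I = {initial_monomial ord f | f. f \<in> I \<and> f \<noteq> 0}"

text \<open>Multiplying by \<open>xpow s\<close> translates the support, and translation preserves
  the order.\<close>

lemma initial_monomials_add:
  assumes ord: "term_order ord" and I: "R.subspace I" and t: "t \<in> initial_monomials ord I"
  shows "s + t \<in> initial_monomials ord I"
proof -
  obtain f where f: "f \<in> I" "f \<noteq> 0" "t = initial_monomial ord f"
    using t by (auto simp: initial_monomials_def)
  have t: "t \<in> Poly_Mapping.keys f" "\<And>u. u \<in> Poly_Mapping.keys f \<Longrightarrow> (u, t) \<in> ord"
    using initial_monomial_greatest[OF ord f(2)] f(3) by auto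
  have "initial_monomial ord (xpow s * f) = s + t"
    by (rule initial_monomial_eqI[OF ord])
      (auto simp: keys_xpow_mult t(1) add.commute[of s] intro: term_order_add[OF ord] t(2))
  moreover have "xpow s * f \<noteq> 0"
    using t(1) keys_xpow_mult[of s f] by (metis empty_iff image_eqI keys_zero)
  ultimately show ?thesis
    using R.subspace_scale[OF I f(1), of "xpow s"] by (force simp: initial_monomials_def)
qed

text \<open>The exponents in \<open>initial_monomials\<close> are closed under translation, so the
  polynomials supported on them already form an ideal. Membership can thus be read off the
  support.\<close>

lemma initial_ideal_eq:
  assumes ord: "term_order ord" and I: "R.subspace I"
  shows "initial_ideal ord I = {f. Poly_Mapping.keys f \<subseteq> initial_monomials ord I}" (is "_ = ?J")
proof -
  have gen: "initial_ideal ord I = R.span (xpow ` initial_monomials ord I)"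
    unfolding initial_ideal_def genideal_eq_span initial_monomials_def
    by (rule arg_cong[where f = R.span]) auto
  have "R.subspace ?J"
    unfolding R.subspace_def
  proof (intro conjI ballI allI)
    fix f g assume "f \<in> ?J" "g \<in> ?J"
    then show "f + g \<in> ?J" using Poly_Mapping.keys_add[of f g] by blast
  next
    fix c f assume "f \<in> ?J"
    then show "c * f \<in> ?J" using keys_mult[of c f] initial_monomials_add[OF ord I] by blast
  qed simp
  then have "R.span (xpow ` initial_monomials ord I) \<subseteq> ?J"
    by (intro R.span_minimal) auto
  moreover have "f \<in> R.span (xpow ` initial_monomials ord I)" if "f \<in> ?J" for f
  proof -
    have "(\<Sum>t\<in>Poly_Mapping.keys f. kscale (Poly_Mapping.lookup f t) (xpow t))
      \<in> R.span (xpow ` initial_monomials ord I)"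
      unfolding kscale_def using that by (intro R.span_sum R.span_scale R.span_base) auto
    then show ?thesis by (simp flip: mpoly_eq_sum_monomials)
  qed
  ultimately show ?thesis unfolding gen by blast
qed

lemma subspace_initial_ideal: "R.subspace (initial_ideal ord I)"
  unfolding initial_ideal_def genideal_eq_span by (rule R.subspace_span)

lemma graded_initial_ideal: "graded (initial_ideal ord I)"
  unfolding initial_ideal_def genideal_eq_span
  by (rule graded_span) (use xpow_homog in blast)

text \<open>A nonzero combination lying in \<open>I\<close> would have its initial monomial both in
  \<open>A\<close> and among the initial monomials of \<open>I\<close>.\<close>

lemma indep_mod_standard_monomials:
  assumes ord: "term_order ord" and fin: "finite A" and A: "A \<inter> initial_monomials ord I = {}"
  shows "indep_mod I xpow A"
  unfolding indep_mod_def
proof (intro allI impI ballI)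
  fix c a assume sum: "(\<Sum>a\<in>A. kscale (c a) (xpow a)) \<in> I" and a: "a \<in> A"
  define f where "f = (\<Sum>a\<in>A. kscale (c a) (xpow a))"
  have lookup: "Poly_Mapping.lookup f t = (if t \<in> A then c t else 0)" for t
  proof -
    have "Poly_Mapping.lookup f t = (\<Sum>a\<in>A. if a = t then c a else 0)"
      by (auto simp: f_def lookup_sum lookup_single intro!: sum.cong)
    then show ?thesis using fin by simp
  qed
  have "f = 0"
  proof (rule ccontr)
    assume "f \<noteq> 0"
    then have "initial_monomial ord f \<in> initial_monomials ord I"
      using sum by (auto simp: initial_monomials_def f_def)
    moreover have "initial_monomial ord f \<in> A"
      using initial_monomial_greatest[OF ord \<open>f \<noteq> 0\<close>] lookup by (auto simp: in_keys_iff split: if_splits)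
    ultimately show False using A by blast
  qed
  then show "c a = 0" using lookup[of a] a by simp
qed

text \<open>Passing to the component that contains \<open>t\<close> and dividing by the leading
  coefficient only shrinks the support, so \<open>t\<close> stays the greatest exponent.\<close>

lemma initial_monomial_witness:
  assumes ord: "term_order ord" and I: "R.subspace I" "graded I" and t: "t \<in> initial_monomials ord I"
  shows "\<exists>f\<in>I. f \<in> homog (total_degree t) \<and> Poly_Mapping.lookup f t = 1
    \<and> (\<forall>s\<in>Poly_Mapping.keys f. (s, t) \<in> ord)"
proof -
  obtain g where g: "g \<in> I" "g \<noteq> 0" "t = initial_monomial ord g"
    using t by (auto simp: initial_monomials_def)
  have t: "t \<in> Poly_Mapping.keys g" "\<And>u. u \<in> Poly_Mapping.keys g \<Longrightarrow> (u, t) \<in> ord"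
    using initial_monomial_greatest[OF ord g(2)] g(3) by auto
  let ?f = "kscale (inverse (Poly_Mapping.lookup g t)) (hom_part (total_degree t) g)"
  show ?thesis
  proof (intro bexI conjI ballI)
    show "?f \<in> I"
      using I g by (auto simp: graded_def intro: K.subspace_scale[OF subspace_K])
    show "?f \<in> homog (total_degree t)"
      by (rule K.subspace_scale[OF subspace_homog]) (rule hom_part_homog)
    show "Poly_Mapping.lookup ?f t = 1" using t(1) by (simp add: lookup_hom_part in_keys_iff)
    show "(s, t) \<in> ord" if "s \<in> Poly_Mapping.keys ?f" for s
      using that by (intro t(2)) (auto simp: in_keys_iff lookup_hom_part when_def split: if_splits)
  qed
qed

section \<open>Minimal reductions\<close>

lemma K_span_subset_R_span: "K.span S \<subseteq> R.span S"
  by (rule K.span_minimal) (auto intro: R.span_base subspace_K)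

lemma finite_exponents_total_degree: "finite {t :: ('n::finite) monomial. total_degree t = n}"
  by (rule finite_subset[OF _ finite_total_degree_le[of n]]) auto

lemma homog_subset_span_monomials: "homog n \<subseteq> K.span (xpow ` {t. total_degree t = n})"
proof
  fix f :: "('a, 'b) mpoly" assume "f \<in> homog n"
  then have "xpow t \<in> xpow ` {t. total_degree t = n}" if "t \<in> Poly_Mapping.keys f" for t
    using that by (auto simp: homogeneous_of_degree_def)
  then show "f \<in> K.span (xpow ` {t. total_degree t = n})"
    by (rule mpoly_in_span_monomials[OF K.span_base])
qed

section \<open>Reductions and their generators\<close>

lemma homog_Suc_subset_span:
  fixes S :: "('n::finite, 'k::field) mpoly set"
  assumes "homog n \<subseteq> R.span S"
  shows "homog (Suc n) \<subseteq> R.span S"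
proof -
  have "(xpow t :: ('n, 'k) mpoly) \<in> R.span S" if t: "total_degree t = Suc n" for t
  proof -
    obtain i where i: "Poly_Mapping.lookup t i \<noteq> 0"
      using t by (auto simp: total_degree_def elim!: sum.not_neutral_contains_not_neutral
          intro: ccontr dest: arg_cong[where f = "\<lambda>n. n = 0"])
    define s where "s = t - Poly_Mapping.single i 1"
    have "t = Poly_Mapping.single i 1 + s"
      using i by (intro poly_mapping_eqI) (auto simp: s_def lookup_add lookup_minus lookup_single when_def)
    moreover have "total_degree (Poly_Mapping.single i (1::nat)) = 1"
      by (simp add: total_degree_def lookup_single when_def)
    ultimately have s: "total_degree s = n"
      and eq: "xpow t = xpow (Poly_Mapping.single i 1) * (xpow s :: ('n, 'k) mpoly)"
      using t by (auto simp: total_degree_add mult_single)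
    have "(xpow s :: ('n, 'k) mpoly) \<in> homog n" using xpow_homog s by blast
    then show ?thesis unfolding eq using assms by (intro R.span_scale) blast
  qed
  then have "K.span (xpow ` {t. total_degree t = Suc n}) \<subseteq> R.span S"
    by (intro K.span_minimal subspace_K) auto
  then show ?thesis using homog_subset_span_monomials by blast
qed

lemma homog_subset_span_mono:
  assumes "homog m \<subseteq> R.span S" "m \<le> n"
  shows "homog n \<subseteq> R.span S"
  using assms(2,1) by (induction rule: dec_induct) (auto dest: homog_Suc_subset_span)

text \<open>Every monomial of positive degree is a variable times one of lower degree, so
  containment of one component forces containment of all later ones.\<close>

lemma reducesI: "L \<subseteq> homog 1 \<Longrightarrow> homog n \<subseteq> R.span (I \<union> L) \<Longrightarrow> reduces I L"
  unfolding reduces_def using homog_subset_span_mono by blast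

text \<open>An independent subset of \<open>V\<close> of largest size spans; the sizes are bounded
  by \<open>card B\<close>.\<close>

lemma exists_basis_mod:
  assumes I: "K.subspace I" and B: "finite B" "V \<subseteq> K.span (I \<union> B)"
  shows "\<exists>Z\<subseteq>V. finite Z \<and> indep_mod I id Z \<and> V \<subseteq> K.span (I \<union> Z)"
proof -
  let ?P = "\<lambda>Z. Z \<subseteq> V \<and> finite Z \<and> indep_mod I id Z"
  have bound: "card Z \<le> card B" if "?P Z" for Z
    using indep_mod_card_le[OF I _ B(1), of Z id] that B(2) by auto
  have "?P {}" by (simp add: indep_mod_def)
  then have "\<exists>Z. ?P Z \<and> (\<forall>Z'. ?P Z' \<longrightarrow> card Z' \<le> card Z)"
    by (rule Lattices_Big.ex_has_greatest_nat[where b = "Suc (card B)"]) (use bound less_Suc_eq_le in blast)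
  then obtain Z where Z: "?P Z" "\<And>Z'. ?P Z' \<Longrightarrow> card Z' \<le> card Z" by blast
  have "v \<in> K.span (I \<union> Z)" if "v \<in> V" for v
  proof (rule ccontr)
    assume v: "v \<notin> K.span (I \<union> Z)"
    then have "v \<notin> Z" by (auto intro: K.span_base)
    moreover have "?P (insert v Z)" using Z(1) that indep_mod_insert[of Z I id v] v by simp
    then have "card (insert v Z) \<le> card Z" by (rule Z(2))
    ultimately show False using Z(1) by simp
  qed
  then show ?thesis using Z(1) by blast
qed

text \<open>A k-basis of \<open>L\<close> modulo \<open>I\<close>, chosen inside \<open>L\<close>,
  generates the same ideal together with \<open>I\<close>.\<close>

lemma reduces_independent_generators:
  assumes I: "R.subspace I" and L: "reduces I L"
  obtains Z where "finite Z" "Z \<subseteq> homog 1" "indep_mod I id Z"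
    "R.span (I \<union> Z) = R.span (I \<union> L)" "reduces I Z"
proof -
  have L1: "L \<subseteq> homog 1" using L by (simp add: reduces_def)
  then have "L \<subseteq> K.span (I \<union> xpow ` {t. total_degree t = 1})"
    using homog_subset_span_monomials[of 1] K.span_mono[of _ "I \<union> xpow ` {t. total_degree t = 1}"] by blast
  then obtain Z where Z: "Z \<subseteq> L" "finite Z" "indep_mod I id Z" "L \<subseteq> K.span (I \<union> Z)"
    using exists_basis_mod[OF subspace_K[OF I] finite_imageI[OF finite_exponents_total_degree], of L xpow 1] by auto
  have "R.span (I \<union> L) \<subseteq> R.span (I \<union> Z)"
    using Z(4) K_span_subset_R_span[of "I \<union> Z"] R.span_superset[of "I \<union> Z"]
    by (intro R.span_minimal) auto
  moreover have "R.span (I \<union> Z) \<subseteq> R.span (I \<union> L)"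
    using Z(1) by (intro R.span_mono) auto
  ultimately have eq: "R.span (I \<union> Z) = R.span (I \<union> L)" by blast
  have "reduces I Z" using L Z(1) L1 by (auto simp: reduces_def eq)
  with Z L1 eq show ?thesis by (intro that) auto
qed

text \<open>A strictly smaller reduction has independent generators \<open>Z\<close> and misses some
  \<open>y \<in> Y\<close>. Then \<open>insert y Z\<close> is independent within the k-span of
  \<open>I\<close> and \<open>Y\<close>, so \<open>Z\<close> has fewer elements than
  \<open>Y\<close>.\<close>

lemma minimally_reducesI:
  assumes I: "R.subspace I" "graded I" and Y: "finite Y" "reduces I Y"
    and le: "\<And>Z. finite Z \<Longrightarrow> indep_mod I id Z \<Longrightarrow> reduces I Z \<Longrightarrow> card Y \<le> card Z"
  shows "minimally_reduces I Y"
  unfolding minimally_reduces_def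
proof (intro conjI notI)
  assume "\<exists>L'. reduces I L' \<and> R.span (I \<union> L') \<subset> R.span (I \<union> Y)"
  then obtain L' where L': "reduces I L'" "R.span (I \<union> L') \<subset> R.span (I \<union> Y)" by blast
  obtain Z where Z: "finite Z" "Z \<subseteq> homog 1" "indep_mod I id Z" "R.span (I \<union> Z) = R.span (I \<union> L')" "reduces I Z"
    using reduces_independent_generators[OF I(1) L'(1)] .
  have Y1: "Y \<subseteq> homog 1" using Y by (simp add: reduces_def)
  have "\<not> Y \<subseteq> R.span (I \<union> Z)"
  proof
    assume "Y \<subseteq> R.span (I \<union> Z)"
    then have "R.span (I \<union> Y) \<subseteq> R.span (I \<union> Z)"
      using R.span_superset[of "I \<union> Z"] by (intro R.span_minimal) auto
    then show False using L' Z(4) by blast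
  qed
  then obtain y where y: "y \<in> Y" "y \<notin> K.span (I \<union> Z)"
    using K_span_subset_R_span[of "I \<union> Z"] by blast
  have "Z \<subseteq> R.span (I \<union> Y)"
    using L'(2) Z(4) R.span_superset[of "I \<union> Z"] by blast
  \<comment> \<open>The elements of \<open>Z\<close> are linear forms, so ideal membership yields
    membership in the k-linear span.\<close>
  then have "insert y Z \<subseteq> K.span (I \<union> Y)"
    using linear_form_in_span[OF I Y1] Z(2) y(1) by (auto intro: K.span_base)
  then have "card (insert y Z) \<le> card Y"
    using indep_mod_card_le[OF subspace_K[OF I(1)] _ Y(1), of "insert y Z" id] indep_mod_insert[OF Z(1,3), of y] y(2) Z(1)
    by auto
  moreover have "y \<notin> Z" using y(2) by (auto intro: K.span_base)
  ultimately show False using le[OF Z(1,3,5)] Z(1) by simp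
qed (rule Y)

text \<open>A finite set of forms of least size giving a reduction is minimal, and the set of all
  linear forms shows that there is a reduction at all.\<close>

lemma exists_minimally_reduces:
  assumes I: "R.subspace I" "graded I"
  shows "\<exists>L. minimally_reduces I L"
proof -
  let ?P = "\<lambda>Y. finite Y \<and> reduces I Y"
  have "reduces I (homog 1)"
    by (rule reducesI[of _ 1]) (auto intro: R.span_base)
  then obtain Y where "?P Y" using reduces_independent_generators[OF I(1)] by metis
  then obtain Y where Y: "?P Y" "\<And>Z. ?P Z \<Longrightarrow> card Y \<le> card Z"
    using ex_has_least_nat[of ?P Y card] by auto
  then show ?thesis using minimally_reducesI[OF I] by blast
qed

section \<open>Algebraic independence by Noether normalization\<close>

lemma prod_congruent:
  assumes J: "R.subspace J" and "finite Z" "\<And>z. z \<in> Z \<Longrightarrow> f z - g z \<in> J"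
  shows "prod f Z - prod g Z \<in> J"
  using assms(2,3)
proof (induction Z rule: finite_induct)
  case empty
  then show ?case by (simp add: R.subspace_0[OF J])
next
  case (insert x F)
  have "f x * prod f F - g x * prod g F = f x * (prod f F - prod g F) + prod g F * (f x - g x)"
    by (simp add: algebra_simps)
  also have "\<dots> \<in> J"
    using insert by (intro R.subspace_add[OF J] R.subspace_scale[OF J]) auto
  finally show ?case using insert.hyps by simp
qed

lemma power_congruent:
  assumes "R.subspace J" "f - g \<in> J"
  shows "f ^ n - g ^ n \<in> J"
  using prod_congruent[OF assms(1), of "{..<n}" "\<lambda>_. f" "\<lambda>_. g"] assms(2) by simp

lemma kscale_mult: "kscale a f * kscale b g = kscale (a * b) (f * g)"
  by (simp add: kscale_mult_left kscale_mult_right)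

lemma kscale_power: "kscale a f ^ n = kscale (a ^ n) (f ^ n)"
  by (induction n) (auto simp: kscale_mult)

lemma kscale_prod: "(\<Prod>z\<in>Z. kscale (a z) (f z)) = kscale (\<Prod>z\<in>Z. a z) (\<Prod>z\<in>Z. f z)"
  by (induction Z rule: infinite_finite_induct) (auto simp: kscale_mult)

text \<open>A polynomial relation F among the elements of \<open>Z\<close> modulo \<open>J\<close>
  would permit a projection from a point \<open>p\<close> with F(p) nonzero, and the projected forms
  would give a reduction with one generator fewer inside \<open>(Z)\<close>. Exponents below
  \<open>b\<close> form a finite box, convenient for counting.\<close>

lemma minimal_reduction_algebraically_independent:
  fixes J :: "('n::finite, 'k::field) mpoly set"
  assumes inf: "infinite (UNIV :: 'k set)" and J: "R.subspace J" "graded J"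
    and Z: "finite Z" "Z \<noteq> {}" "indep_mod J id Z" and min: "minimally_reduces J Z"
  shows "indep_mod J (\<lambda>a. \<Prod>z\<in>Z. z ^ a z) (PiE Z (\<lambda>_. {..<b}))"
  unfolding indep_mod_def
proof (intro allI impI ballI, rule ccontr)
  let ?v = "\<lambda>a. \<Prod>z\<in>Z. z ^ a z" and ?A = "PiE Z (\<lambda>_. {..<b::nat})"
  fix c a0 assume F: "(\<Sum>a\<in>?A. kscale (c a) (?v a)) \<in> J" and a0: "a0 \<in> ?A" "c a0 \<noteq> 0"
  have finA: "finite ?A" using Z(1) by (intro finite_PiE) auto
  have Z1: "Z \<subseteq> homog 1" using min by (simp add: minimally_reduces_def reduces_def)
  \<comment> \<open>As \<open>J\<close> is graded, the relation may be replaced by its part of the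
    degree of the offending term \<open>a0\<close>.\<close>
  define e where "e = sum a0 Z"
  let ?S = "{a \<in> ?A. sum a Z = e}"
  have v: "?v a \<in> homog (sum a Z)" for a
  proof (rule homog_prod[OF Z(1)])
    fix z assume "z \<in> Z"
    then show "z ^ a z \<in> homog (a z)" using homog_power[of z 1 "a z"] Z1 by auto
  qed
  have "hom_part e (\<Sum>a\<in>?A. kscale (c a) (?v a)) = (\<Sum>a\<in>?A. if sum a Z = e then kscale (c a) (?v a) else 0)"
    unfolding hom_part_sum hom_part_kscale hom_part_of_homog[OF v] by (intro sum.cong) auto
  also have "\<dots> = (\<Sum>a\<in>?S. kscale (c a) (?v a))"
    by (rule sum.inter_filter[OF finA, symmetric])
  finally have hom: "hom_part e (\<Sum>a\<in>?A. kscale (c a) (?v a)) = (\<Sum>a\<in>?S. kscale (c a) (?v a))" .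
  have "hom_part e (\<Sum>a\<in>?A. kscale (c a) (?v a)) \<in> J"
    using J(2) F unfolding graded_def by blast
  then have Fe: "(\<Sum>a\<in>?S. kscale (c a) (?v a)) \<in> J" unfolding hom .

  have single: "{a. a \<in> ?S \<and> (\<forall>z\<in>Z. a z = a0 z)} = {a0}"
  proof (rule Set.set_eqI, rule iffI)
    fix a assume "a \<in> {a. a \<in> ?S \<and> (\<forall>z\<in>Z. a z = a0 z)}"
    then have "a \<in> ?A" "\<And>z. z \<in> Z \<Longrightarrow> a z = a0 z" by auto
    then show "a \<in> {a0}" using PiE_ext[OF _ a0(1)] by simp
  next
    fix a assume "a \<in> {a0}"
    then show "a \<in> {a. a \<in> ?S \<and> (\<forall>z\<in>Z. a z = a0 z)}" using a0(1) e_def by simp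
  qed
  have nonzero: "(\<Sum>a | a \<in> ?S \<and> (\<forall>z\<in>Z. a z = a0 z). c a) \<noteq> 0"
    unfolding single using a0(2) by simp
  have finS: "finite ?S" using finA by (rule rev_finite_subset) blast
  \<comment> \<open>A point with nonzero coordinates at which the homogeneous relation does not
    vanish; \<open>G\<close> is its value there.\<close>
  obtain p where p: "\<And>z. z \<in> Z \<Longrightarrow> p z \<noteq> 0" and p0: "(\<Sum>a\<in>?S. c a * (\<Prod>z\<in>Z. p z ^ a z)) \<noteq> 0"
    using monomial_combination_nonzero[OF inf Z(1) finS nonzero] by blast
  define G where "G = (\<Sum>a\<in>?S. c a * (\<Prod>z\<in>Z. p z ^ a z))"
  have G: "G \<noteq> 0" unfolding G_def by (rule p0)
  obtain w where w: "w \<in> Z" using Z(2) by blast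
  \<comment> \<open>These combinations vanish at \<open>p\<close>. Modulo them every
    \<open>z\<close> becomes \<open>p z / p w\<close> times \<open>w\<close>, and
    \<open>y w = 0\<close>, so \<open>w\<close> itself is left out of \<open>Y\<close>.\<close>
  define y where "y = (\<lambda>z. kscale (p w) z - kscale (p z) w)"
  define Y where "Y = y ` (Z - {w})"
  let ?J = "R.span (J \<union> Y)"
  have J': "R.subspace ?J" by (rule R.subspace_span)
  have y: "y z \<in> ?J" if "z \<in> Z" for z
  proof (cases "z = w")
    case True
    then show ?thesis by (simp add: y_def R.span_zero)
  next
    case False
    then show ?thesis using that by (auto simp: Y_def intro: R.span_base)
  qed
  have JJ: "J \<subseteq> ?J" by (auto intro: R.span_base)
  have Y1: "Y \<subseteq> homog 1"
  proof
    fix l assume "l \<in> Y"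
    then obtain z where z: "z \<in> Z" "l = kscale (p w) z - kscale (p z) w" by (auto simp: Y_def y_def)
    show "l \<in> homog 1"
      unfolding z(2) using Z1 z(1) w by (intro K.subspace_diff K.subspace_scale subspace_homog) blast+
  qed

  \<comment> \<open>All exponents in \<open>?S\<close> sum to \<open>e\<close>, so replacing each
    \<open>kscale (p w) z\<close> by \<open>kscale (p z) w\<close> turns the relation into
    \<open>kscale G (w ^ e)\<close>. Hence \<open>w ^ e\<close> lies in the ideal.\<close>
  have "kscale (p w ^ e) (?v a) - kscale (\<Prod>z\<in>Z. p z ^ a z) (w ^ e) \<in> ?J" if a: "a \<in> ?S" for a
  proof -
    have "(\<Prod>z\<in>Z. kscale (p w) z ^ a z) - (\<Prod>z\<in>Z. kscale (p z) w ^ a z) \<in> ?J"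
      using y by (intro prod_congruent[OF J' Z(1)] power_congruent[OF J']) (auto simp: y_def)
    then show ?thesis
      using a by (simp add: kscale_power kscale_prod flip: power_sum)
  qed
  then have "(\<Sum>a\<in>?S. kscale (c a) (kscale (p w ^ e) (?v a) - kscale (\<Prod>z\<in>Z. p z ^ a z) (w ^ e))) \<in> ?J"
    by (intro K.subspace_sum K.subspace_scale subspace_K[OF J']) auto
  also have "(\<Sum>a\<in>?S. kscale (c a) (kscale (p w ^ e) (?v a) - kscale (\<Prod>z\<in>Z. p z ^ a z) (w ^ e)))
    = kscale (p w ^ e) (\<Sum>a\<in>?S. kscale (c a) (?v a)) - kscale G (w ^ e)"
    by (simp add: G_def K.scale_right_diff_distrib sum_subtractf K.scale_sum_right K.scale_sum_left mult.commute)
  finally have 1: "kscale (p w ^ e) (\<Sum>a\<in>?S. kscale (c a) (?v a)) - kscale G (w ^ e) \<in> ?J" .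
  have 2: "kscale (p w ^ e) (\<Sum>a\<in>?S. kscale (c a) (?v a)) \<in> ?J"
    using Fe JJ by (intro K.subspace_scale subspace_K[OF J']) auto
  have "kscale G (w ^ e) \<in> ?J"
    using R.subspace_diff[OF J' 2 1] by simp
  then have "kscale (inverse G) (kscale G (w ^ e)) \<in> ?J"
    by (rule K.subspace_scale[OF subspace_K[OF J']])
  then have we: "w ^ e \<in> ?J" using G by simp

  obtain N where N: "\<And>n. n \<ge> N \<Longrightarrow> homog n \<subseteq> R.span (J \<union> Z)"
    using min by (auto simp: minimally_reduces_def reduces_def)
  \<comment> \<open>From degree \<open>N\<close> on, forms lie in the ideal of \<open>J\<close> and
    \<open>Z\<close>, and each \<open>z\<close> is a multiple of \<open>w\<close> modulo
    \<open>Y\<close>; so one factor \<open>w\<close> can be extracted.\<close>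
  have step: "\<exists>h\<in>homog n. g - w * h \<in> ?J" if g: "g \<in> homog (Suc n)" and n: "Suc n \<ge> N" for g n
  proof -
    let ?V = "{g. \<exists>h\<in>homog n. g - w * h \<in> ?J}"
    have "K.subspace ?V"
      unfolding K.subspace_def
    proof (intro conjI ballI allI)
      show "0 \<in> ?V"
        using K.subspace_0[OF subspace_homog, of n] by (force simp: R.span_zero)
    next
      fix f g assume "f \<in> ?V" "g \<in> ?V"
      then obtain h1 h2 where h: "h1 \<in> homog n" "f - w * h1 \<in> ?J" "h2 \<in> homog n" "g - w * h2 \<in> ?J" by blast
      have eq: "(f + g) - w * (h1 + h2) = (f - w * h1) + (g - w * h2)" by (simp add: algebra_simps)
      have "(f + g) - w * (h1 + h2) \<in> ?J" unfolding eq by (rule R.span_add[OF h(2,4)])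
      moreover have "h1 + h2 \<in> homog n" by (rule K.subspace_add[OF subspace_homog h(1,3)])
      ultimately show "f + g \<in> ?V" by blast
    next
      fix a g assume "g \<in> ?V"
      then obtain h where h: "h \<in> homog n" "g - w * h \<in> ?J" by blast
      have "kscale a g - w * kscale a h = kscale a (g - w * h)"
        by (simp add: kscale_mult_right K.scale_right_diff_distrib)
      then have "kscale a g - w * kscale a h \<in> ?J"
        using K.subspace_scale[OF subspace_K[OF J'] h(2)] by simp
      moreover have "kscale a h \<in> homog n" by (rule K.subspace_scale[OF subspace_homog h(1)])
      ultimately show "kscale a g \<in> ?V" by blast
    qed
    moreover have "J \<subseteq> ?V"
    proof
      fix f assume "f \<in> J"
      then have "f - w * 0 \<in> ?J" using JJ by auto
      then show "f \<in> ?V" using K.subspace_0[OF subspace_homog, of n] by blast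
    qed
    moreover have "xpow t * z \<in> ?V" if t: "total_degree t = n" and z: "z \<in> Z" for t z
    proof -
      have "xpow t * z - w * kscale (p z / p w) (xpow t) = (kscale (inverse (p w)) (xpow t)) * y z"
        using p[OF w] by (simp add: y_def kscale_mult_right kscale_mult_left right_diff_distrib
            K.scale_right_diff_distrib divide_inverse mult_ac)
      also have "\<dots> \<in> ?J" by (rule R.span_scale) (rule y[OF z])
      finally have "xpow t * z - w * kscale (p z / p w) (xpow t) \<in> ?J" .
      moreover have "kscale (p z / p w) (xpow t) \<in> homog n"
        using K.subspace_scale[OF subspace_homog xpow_homog[of t]] t by simp
      ultimately show ?thesis by blast
    qed
    ultimately have "K.span (J \<union> {xpow t * l | t l. total_degree t = n \<and> l \<in> Z}) \<subseteq> ?V"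
      by (intro K.span_minimal) auto
    moreover have "g \<in> K.span (J \<union> {xpow t * l | t l. total_degree t = n \<and> l \<in> Z})"
      using N[OF n] g by (intro homog_in_span_linear[OF J Z1]) auto
    ultimately show ?thesis by blast
  qed
  have reduce: "\<exists>h\<in>homog n. g - w ^ k * h \<in> ?J" if "g \<in> homog (n + k)" "n \<ge> N" for g n k
    using that
  proof (induction k arbitrary: n)
    case 0
    then show ?case by (intro bexI[of _ g]) (auto simp: R.span_zero)
  next
    case (Suc k)
    have "g \<in> homog (Suc n + k)" "Suc n \<ge> N" using Suc.prems by simp_all
    from Suc.IH[OF this] obtain h where h: "h \<in> homog (Suc n)" "g - w ^ k * h \<in> ?J" by blast
    then obtain h' where h': "h' \<in> homog n" "h - w * h' \<in> ?J"
      using step[of h n] Suc.prems(2) by auto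
    have "g - w ^ Suc k * h' = (g - w ^ k * h) + w ^ k * (h - w * h')"
      by (simp add: algebra_simps)
    also have "\<dots> \<in> ?J" by (intro R.span_add R.span_scale h h')
    finally show ?case using h'(1) by blast
  qed
  \<comment> \<open>In degree \<open>N + e\<close> the extraction can be repeated \<open>e\<close>
    times, and \<open>w ^ e\<close> is already in the ideal.\<close>
  have "g \<in> ?J" if g: "g \<in> homog (N + e)" for g
  proof -
    obtain h where "g - w ^ e * h \<in> ?J"
      using reduce[OF g order_refl] by blast
    moreover have "h * w ^ e \<in> ?J" by (rule R.span_scale[OF we])
    ultimately have "(g - w ^ e * h) + h * w ^ e \<in> ?J" by (rule R.span_add)
    then show ?thesis by (simp add: mult.commute)
  qed
  then have "reduces J Y" by (intro reducesI[OF Y1, of "N + e"]) blast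
  moreover have "?J \<subseteq> R.span (J \<union> Z)"
  proof (rule R.span_minimal)
    have "y z \<in> R.span (J \<union> Z)" if "z \<in> Z" for z
      unfolding y_def kscale_def using that w by (intro R.span_diff R.span_scale R.span_base) auto
    then show "J \<union> Y \<subseteq> R.span (J \<union> Z)" by (auto simp: Y_def intro: R.span_base)
  qed simp
  \<comment> \<open>Minimality makes the two ideals equal, so the independent set \<open>Z\<close>
    lies in the k-span of \<open>J\<close> and the smaller set \<open>Y\<close>.\<close>
  ultimately have "?J = R.span (J \<union> Z)"
    using min by (auto simp: minimally_reduces_def)
  then have "Z \<subseteq> ?J" by (auto intro: R.span_base)
  then have "Z \<subseteq> K.span (J \<union> Y)"
    using linear_form_in_span[OF J Y1] Z1 by blast
  then have "card Z \<le> card Y"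
    using indep_mod_card_le[OF subspace_K[OF J(1)] Z(1) _ Z(3), of Y] Z(1) by (auto simp: Y_def)
  also have "\<dots> \<le> card (Z - {w})" unfolding Y_def by (rule card_image_le) (use Z in simp)
  also have "\<dots> < card Z" using w Z(1) by (intro psubset_card_mono) auto
  finally show False by simp
qed

section \<open>Counting standard monomials\<close>

lemma mult_right_in_span:
  assumes I: "R.subspace I" and f: "f \<in> K.span (I \<union> B)"
    and B: "\<And>g. g \<in> B \<Longrightarrow> g * l \<in> K.span (I \<union> C)"
  shows "f * l \<in> K.span (I \<union> C)"
proof -
  have "K.subspace {f. f * l \<in> K.span (I \<union> C)}"
    unfolding K.subspace_def
    by (simp add: K.span_zero distrib_right kscale_mult_left K.span_add K.span_scale)
  moreover have "g * l \<in> I" if "g \<in> I" for g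
    using R.subspace_scale[OF I that, of l] by (simp add: mult.commute)
  then have "I \<union> B \<subseteq> {f. f * l \<in> K.span (I \<union> C)}"
    using B by (auto intro: K.span_base)
  ultimately show ?thesis using K.span_minimal f by blast
qed

text \<open>Modulo \<open>I\<close> the polynomial ring is generated by finitely many monomials as a
  module over the subalgebra generated by \<open>Z\<close>. So the part of degree at most
  \<open>n\<close> grows at most like \<open>n\<close> to the power \<open>card Z\<close>.\<close>

lemma reduction_growth:
  fixes I :: "('n::finite, 'k::field) mpoly set"
  assumes I: "R.subspace I" "graded I" and Z: "finite Z" "reduces I Z"
  obtains C where "\<And>n. \<exists>B. finite B \<and> card B \<le> C * Suc n ^ card Z
    \<and> (\<forall>t. total_degree t \<le> n \<longrightarrow> (xpow t :: ('n, 'k) mpoly) \<in> K.span (I \<union> B))"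
proof -
  have Z1: "Z \<subseteq> homog 1" using Z by (simp add: reduces_def)
  obtain N where N: "\<And>n. n \<ge> N \<Longrightarrow> homog n \<subseteq> R.span (I \<union> Z)"
    using Z by (auto simp: reduces_def)
  let ?T = "{t :: 'n monomial. total_degree t \<le> N}" and ?A = "\<lambda>n. PiE Z (\<lambda>_. {..n::nat})"
  let ?v = "\<lambda>(a, t). (\<Prod>z\<in>Z. z ^ a z) * (xpow t :: ('n, 'k) mpoly)"
  \<comment> \<open>Power products in \<open>Z\<close> with exponents up to \<open>n\<close>, times
    monomials of degree up to \<open>N\<close>; the latter give the constant
    \<open>C = card ?T\<close>.\<close>
  define B where "B = (\<lambda>n. ?v ` (?A n \<times> ?T))"
  have finB: "finite (B n)" for n
    unfolding B_def by (intro finite_imageI finite_cartesian_product finite_PiE Z(1) finite_total_degree_le) auto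
  have "card (B n) \<le> card (?A n \<times> ?T)" for n
    unfolding B_def
    by (intro card_image_le finite_cartesian_product finite_PiE Z(1) finite_total_degree_le) auto
  then have cardB: "card (B n) \<le> card ?T * Suc n ^ card Z" for n
    by (simp add: card_cartesian_product card_PiE Z(1) mult.commute)
  have mono: "B n \<subseteq> B (Suc n)" for n
    unfolding B_def by (intro image_mono Sigma_mono PiE_mono) auto
  have mult: "f * l \<in> B (Suc n)" if f: "f \<in> B n" and l: "l \<in> Z" for f l n
  proof -
    obtain a t where a: "a \<in> ?A n" and t: "t \<in> ?T" and f: "f = (\<Prod>z\<in>Z. z ^ a z) * xpow t"
      using f by (auto simp: B_def)
    let ?a = "a(l := Suc (a l))"
    have "(\<Prod>z\<in>Z. z ^ ?a z) = l ^ ?a l * (\<Prod>z\<in>Z - {l}. z ^ ?a z)"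
      by (rule prod.remove[OF Z(1) l])
    also have "(\<Prod>z\<in>Z - {l}. z ^ ?a z) = (\<Prod>z\<in>Z - {l}. z ^ a z)"
      by (rule prod.cong) auto
    also have "l ^ ?a l * (\<Prod>z\<in>Z - {l}. z ^ a z) = (\<Prod>z\<in>Z. z ^ a z) * l"
      by (simp add: prod.remove[OF Z(1) l] mult_ac)
    finally have "f * l = ?v (?a, t)" by (simp add: f mult_ac)
    moreover have "?a \<in> ?A (Suc n)"
      using a l by (auto simp: PiE_iff extensional_def le_Suc_eq)
    ultimately show ?thesis using t unfolding B_def by blast
  qed
  have "(xpow t :: ('n, 'k) mpoly) \<in> K.span (I \<union> B n)" if "total_degree t \<le> n" for t n
    using that
  proof (induction n arbitrary: t)
    case 0
    have "?v (\<lambda>z\<in>Z. 0, 0) \<in> B 0"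
      unfolding B_def by (intro imageI SigmaI) auto
    then have "1 \<in> B 0" by simp
    with 0 show ?case by (auto intro: K.span_base)
  next
    case (Suc n)
    \<comment> \<open>A monomial of new degree is a module generator if its degree is at most
      \<open>N\<close>; otherwise it lies in the ideal of \<open>I\<close> and \<open>Z\<close>, and
      multiplying \<open>B n\<close> by an element of \<open>Z\<close> lands in
      \<open>B (Suc n)\<close>.\<close>
    consider "total_degree t \<le> n" | "total_degree t = Suc n" "Suc n \<le> N" | "total_degree t = Suc n" "N \<le> Suc n"
      using Suc.prems by linarith
    then show ?case
    proof cases
      case 1
      then show ?thesis
        using Suc.IH[of t] K.span_mono[of "I \<union> B n" "I \<union> B (Suc n)"] mono[of n] by blast
    next
      case 2
      have "?v (\<lambda>z\<in>Z. 0, t) \<in> B (Suc n)"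
        unfolding B_def by (intro imageI SigmaI) (use 2 in auto)
      then have "xpow t \<in> B (Suc n)" by simp
      then show ?thesis by (auto intro: K.span_base)
    next
      case 3
      have t: "(xpow t :: ('n, 'k) mpoly) \<in> homog (Suc n)" using xpow_homog 3 by metis
      then have "(xpow t :: ('n, 'k) mpoly) \<in> R.span (I \<union> Z)" using N 3 by blast
      from homog_in_span_linear[OF I Z1 this t]
      have "(xpow t :: ('n, 'k) mpoly) \<in> K.span (I \<union> {xpow t * l | t l. total_degree t = n \<and> l \<in> Z})" .
      moreover have "(xpow s :: ('n, 'k) mpoly) * l \<in> K.span (I \<union> B (Suc n))"
        if "total_degree s = n" "l \<in> Z" for s l
      proof (rule mult_right_in_span[OF I(1)])
        show "xpow s \<in> K.span (I \<union> B n)" using that Suc.IH[of s] by simp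
        show "g * l \<in> K.span (I \<union> B (Suc n))" if "g \<in> B n" for g
          using mult[OF that \<open>l \<in> Z\<close>] by (auto intro: K.span_base)
      qed
      then have "K.span (I \<union> {xpow t * l | t l. total_degree t = n \<and> l \<in> Z}) \<subseteq> K.span (I \<union> B (Suc n))"
        by (intro K.span_minimal K.subspace_span) (auto intro: K.span_base)
      ultimately show ?thesis by blast
    qed
  qed
  with finB cardB show ?thesis by (intro that[of "card ?T"]) blast
qed

text \<open>Standard monomials are counted twice. They span modulo the initial ideal, where the
  power products in \<open>Z\<close> are independent, which bounds their number below; they are
  independent modulo \<open>I\<close>, where \<open>reduction_growth\<close> for \<open>Z'\<close>
  bounds it above.\<close>

lemma card_minimal_reduction_le:
  fixes I :: "('n::finite, 'k::field) mpoly set"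
  assumes inf: "infinite (UNIV :: 'k set)" and ord: "term_order ord"
    and I: "R.subspace I" "graded I"
    and Z: "finite Z" "indep_mod (initial_ideal ord I) id Z" "minimally_reduces (initial_ideal ord I) Z"
    and Z': "finite Z'" "reduces I Z'"
  shows "card Z \<le> card Z'"
proof (rule ccontr)
  let ?J = "initial_ideal ord I" and ?M = "initial_monomials ord I"
  let ?d = "card Z" and ?d' = "card Z'"
  assume "\<not> ?d \<le> ?d'"
  then have d: "Suc ?d' \<le> ?d" "Z \<noteq> {}" using Z(1) by auto
  have Z1: "Z \<subseteq> homog 1" using Z(3) by (simp add: minimally_reduces_def reduces_def)
  obtain C where C: "\<And>n. \<exists>B. finite B \<and> card B \<le> C * Suc n ^ ?d'
    \<and> (\<forall>t. total_degree t \<le> n \<longrightarrow> (xpow t :: ('n, 'k) mpoly) \<in> K.span (I \<union> B))"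
    using reduction_growth[OF I Z'] by blast
  \<comment> \<open>With \<open>n\<close> the largest degree of a power product in the box,
    \<open>Suc n \<le> ?d * b\<close>. As \<open>b\<close> exceeds \<open>C * ?d ^ ?d'\<close>, the
    upper bound falls below \<open>b ^ Suc ?d'\<close> and hence below
    \<open>b ^ ?d\<close>.\<close>
  define b where "b = Suc (C * ?d ^ ?d')"
  define n where "n = ?d * (b - 1)"
  let ?S = "{t. total_degree t \<le> n} - ?M" and ?A = "PiE Z (\<lambda>_. {..<b})"
  let ?v = "\<lambda>a. \<Prod>z\<in>Z. z ^ a z"
  have finS: "finite ?S" by (rule finite_Diff[OF finite_total_degree_le])
  have "card ?A \<le> card (xpow ` ?S :: ('n, 'k) mpoly set)"
  proof (rule indep_mod_card_le)
    show "K.subspace ?J" by (rule subspace_K[OF subspace_initial_ideal])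
    show "finite ?A" using Z(1) by (intro finite_PiE) auto
    show "finite (xpow ` ?S :: ('n, 'k) mpoly set)" using finS by (rule finite_imageI)
    show "indep_mod ?J ?v ?A"
      by (rule minimal_reduction_algebraically_independent[OF inf subspace_initial_ideal
            graded_initial_ideal Z(1) d(2) Z(2,3)])
    fix a assume a: "a \<in> ?A"
    have "?v a \<in> homog (sum a Z)"
    proof (rule homog_prod[OF Z(1)])
      fix z assume "z \<in> Z"
      then show "z ^ a z \<in> homog (a z)" using homog_power[of z 1 "a z"] Z1 by auto
    qed
    moreover have "sum a Z \<le> n"
      unfolding n_def using a sum_bounded_above[of Z a "b - 1"] by (fastforce simp: PiE_iff)
    ultimately have deg: "total_degree t \<le> n" if "t \<in> Poly_Mapping.keys (?v a)" for t
      using that by (auto simp: homogeneous_of_degree_def)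
    show "?v a \<in> K.span (?J \<union> xpow ` ?S)"
    proof (rule mpoly_in_span_monomials)
      fix t assume "t \<in> Poly_Mapping.keys (?v a)"
      then have "(xpow t :: ('n, 'k) mpoly) \<in> ?J \<union> xpow ` ?S"
        using deg[of t] by (auto simp: initial_ideal_eq[OF ord I(1)])
      then show "xpow t \<in> K.span (?J \<union> xpow ` ?S)" by (rule K.span_base)
    qed
  qed
  also have "\<dots> \<le> card ?S" by (rule card_image_le[OF finS])
  finally have 1: "b ^ ?d \<le> card ?S" using Z(1) by (simp add: card_PiE)
  obtain B where B: "finite B" "card B \<le> C * Suc n ^ ?d'"
    "\<And>t. total_degree t \<le> n \<Longrightarrow> (xpow t :: ('n, 'k) mpoly) \<in> K.span (I \<union> B)"
    using C[of n] by blast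
  have "indep_mod I xpow ?S"
    by (rule indep_mod_standard_monomials[OF ord finS]) blast
  then have "card ?S \<le> card B"
    by (rule indep_mod_card_le[OF subspace_K[OF I(1)] finS B(1)]) (use B(3) in auto)
  also note B(2)
  also have "C * Suc n ^ ?d' \<le> C * (?d * b) ^ ?d'"
  proof -
    have "Suc n \<le> ?d * b" using d unfolding n_def b_def by simp
    then show ?thesis by (intro mult_left_mono power_mono) auto
  qed
  also have "\<dots> = (C * ?d ^ ?d') * b ^ ?d'" by (simp add: power_mult_distrib)
  also have "\<dots> < b * b ^ ?d'" unfolding b_def by (intro mult_strict_right_mono) auto
  also have "\<dots> = b ^ Suc ?d'" by simp
  also have "\<dots> \<le> b ^ ?d" by (rule power_increasing[OF d(1)]) (simp add: b_def)
  finally show False using 1 by simp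
qed

section \<open>A determinantal degeneration\<close>

definition monomial_value :: "('n::finite \<Rightarrow> 'k::field) \<Rightarrow> 'n monomial \<Rightarrow> 'k" where
  "monomial_value u t = (\<Prod>x\<in>UNIV. u x ^ Poly_Mapping.lookup t x)"

lemma monomial_value_add: "monomial_value u (s + t) = monomial_value u s * monomial_value u t"
  by (simp add: monomial_value_def lookup_add power_add prod.distrib)

lemma monomial_value_zero [simp]: "monomial_value u 0 = 1"
  by (simp add: monomial_value_def)

lemma monomial_value_sum: "monomial_value u (\<Sum>i\<in>A. t i) = (\<Prod>i\<in>A. monomial_value u (t i))"
  by (induction A rule: infinite_finite_induct) (auto simp: monomial_value_add)

text \<open>The substitution of \<open>u x\<close> times the variable for each variable
  \<open>x\<close>; it acts diagonally on the monomials.\<close>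

definition rescale :: "('n::finite \<Rightarrow> 'k::field) \<Rightarrow> ('n, 'k) mpoly \<Rightarrow> ('n, 'k) mpoly" where
  "rescale u f = Poly_Mapping.mapp (\<lambda>t c. monomial_value u t * c) f"

lemma lookup_rescale [simp]:
  "Poly_Mapping.lookup (rescale u f) t = monomial_value u t * Poly_Mapping.lookup f t"
  by (auto simp: rescale_def lookup_mapp when_def in_keys_iff)

lemma rescale_homog: "f \<in> homog n \<Longrightarrow> rescale u f \<in> homog n"
  by (auto simp: homogeneous_of_degree_def in_keys_iff)

lemma rescale_xpow_mult: "rescale u (xpow t * f) = kscale (monomial_value u t) (xpow t) * rescale u f"
proof (rule poly_mapping_eqI)
  fix s
  show "Poly_Mapping.lookup (rescale u (xpow t * f)) s
    = Poly_Mapping.lookup (kscale (monomial_value u t) (xpow t) * rescale u f) s"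
  proof (cases "s \<in> range ((+) t)")
    case True
    then show ?thesis by (auto simp: kscale_mult_left lookup_xpow_mult monomial_value_add)
  next
    case False
    then have "s \<notin> Poly_Mapping.keys (xpow t * g)" for g :: "('a, 'b) mpoly"
      unfolding keys_xpow_mult by blast
    then show ?thesis by (simp add: kscale_mult_left in_keys_iff)
  qed
qed

text \<open>By the Leibniz formula the determinant is a polynomial in \<open>u\<close>, in which the
  permutation \<open>\<sigma>\<close> contributes to the exponent \<open>E \<sigma>\<close>.
  Replacing the unit rows of \<open>v\<close> in \<open>P\<close> by rows \<open>w\<close> with the
  same leading entries does not change the coefficient at one suitable exponent.\<close>

lemma det_rescaled_nonzero:
  fixes v w :: "nat \<Rightarrow> nat \<Rightarrow> 'k::field" and e :: "nat \<Rightarrow> ('n::finite) monomial"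
  assumes inf: "infinite (UNIV :: 'k set)" and ord: "term_order ord"
    and e: "inj_on e {0..<N}" and P: "P \<subseteq> {0..<N}"
    and \<beta>: "\<And>i. i \<in> P \<Longrightarrow> \<beta> i < N"
    and v: "\<And>i j. i \<in> P \<Longrightarrow> j < N \<Longrightarrow> v i j = (if j = \<beta> i then 1 else 0)"
    and w: "\<And>i. i \<in> P \<Longrightarrow> w i (\<beta> i) = 1"
      "\<And>i j. i \<in> P \<Longrightarrow> j < N \<Longrightarrow> w i j \<noteq> 0 \<Longrightarrow> (e j, e (\<beta> i)) \<in> ord"
    and det: "Determinant.det (mat N N (\<lambda>(i, j). v i j)) \<noteq> 0"
  shows "\<exists>u. Determinant.det (mat N N (\<lambda>(i, j). if i \<in> P then w i j else monomial_value u (e j) * v i j)) \<noteq> 0"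
proof -
  let ?U = "{0..<N}" and ?S = "{\<sigma>. \<sigma> permutes {0..<N}}"
  define E where "E = (\<lambda>\<sigma>. \<Sum>i\<in>?U - P. e (\<sigma> i))"
  define c where "c = (\<lambda>\<sigma>. signof \<sigma> * (\<Prod>i\<in>?U. if i \<in> P then w i (\<sigma> i) else v i (\<sigma> i)))"
  define d where "d = (\<lambda>\<sigma>. signof \<sigma> * (\<Prod>i\<in>?U. v i (\<sigma> i)))"
  have finP: "finite P" using P by (rule finite_subset) simp
  have finS: "finite ?S" by (rule finite_permutations) simp
  have lt: "\<sigma> i < N" if "\<sigma> \<in> ?S" "i \<in> ?U" for \<sigma> i
    using permutes_in_image[of \<sigma> ?U i] that by simp
  have det_v: "Determinant.det (mat N N (\<lambda>(i, j). v i j)) = (\<Sum>\<sigma>\<in>?S. d \<sigma>)"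
    by (subst det_def'[of _ N]) (auto simp: d_def lt intro!: sum.cong prod.cong)
  have det_u: "Determinant.det (mat N N (\<lambda>(i, j). if i \<in> P then w i j else monomial_value u (e j) * v i j))
    = (\<Sum>\<sigma>\<in>?S. c \<sigma> * monomial_value u (E \<sigma>))" for u
  proof -
    have "(\<Prod>i\<in>?U. if i \<in> P then w i (\<sigma> i) else monomial_value u (e (\<sigma> i)) * v i (\<sigma> i))
      = (\<Prod>i\<in>?U. if i \<in> P then w i (\<sigma> i) else v i (\<sigma> i)) * monomial_value u (E \<sigma>)" for \<sigma>
    proof -
      have "monomial_value u (E \<sigma>) = (\<Prod>i\<in>?U - P. monomial_value u (e (\<sigma> i)))"
        unfolding E_def by (rule monomial_value_sum)
      also have "\<dots> = (\<Prod>i\<in>?U. if i \<in> P then 1 else monomial_value u (e (\<sigma> i)))"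
        by (rule prod.mono_neutral_cong_left) auto
      finally show ?thesis by (simp flip: prod.distrib) (auto intro!: prod.cong)
    qed
    then show ?thesis
      by (subst det_def'[of _ N]) (auto simp: c_def lt mult.assoc intro!: sum.cong)
  qed
  have match: "v i (\<sigma> i) = (if \<sigma> i = \<beta> i then 1 else 0)" if "\<sigma> \<in> ?S" "i \<in> P" for \<sigma> i
    using v[OF that(2)] lt[OF that(1)] that(2) P by blast
  \<comment> \<open>Some term of the determinant of \<open>v\<close> is nonzero, and the unit rows
    force its permutation to send every \<open>i \<in> P\<close> to
    \<open>\<beta> i\<close>.\<close>
  obtain \<sigma>0 where \<sigma>0: "\<sigma>0 \<in> ?S" "d \<sigma>0 \<noteq> 0"
    using det unfolding det_v by (rule sum.not_neutral_contains_not_neutral)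
  then have nonzero: "v i (\<sigma>0 i) \<noteq> 0" if "i \<in> ?U" for i
    using that by (auto simp: d_def)
  have \<sigma>0_P: "\<sigma>0 i = \<beta> i" if "i \<in> P" for i
    using nonzero[of i] match[OF \<sigma>0(1) that] that P by (auto split: if_splits)
  \<comment> \<open>The exponents over all rows add up to a constant, so fixing
    \<open>E \<sigma>\<close> amounts to fixing the sum over the rows in \<open>P\<close>.\<close>
  have total: "E \<sigma> + (\<Sum>i\<in>P. e (\<sigma> i)) = sum e ?U" if "\<sigma> \<in> ?S" for \<sigma>
  proof -
    have "E \<sigma> + (\<Sum>i\<in>P. e (\<sigma> i)) = (\<Sum>i\<in>?U. e (\<sigma> i))"
      unfolding E_def by (rule sum.subset_diff[symmetric]) (use P in auto)
    also have "\<dots> = sum e ?U"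
      using sum.permute[of \<sigma> ?U e] that by (simp add: o_def)
    finally show ?thesis .
  qed
  text \<open>The leading-term rows contribute the largest possible exponent exactly when every one
    of them picks its leading entry, so the coefficient of the monomial \<open>E \<sigma>0\<close> is the
    determinant of the initial matrix.\<close>
  have coeff: "(if E \<sigma> = E \<sigma>0 then c \<sigma> else 0) = d \<sigma>" if \<sigma>: "\<sigma> \<in> ?S" for \<sigma>
  proof (cases "\<forall>i\<in>P. \<sigma> i = \<beta> i")
    case True
    then have "(\<Sum>i\<in>P. e (\<sigma> i)) = (\<Sum>i\<in>P. e (\<sigma>0 i))"
      using \<sigma>0_P by simp
    then have "E \<sigma> = E \<sigma>0" using total[OF \<sigma>] total[OF \<sigma>0(1)] by (metis add_right_cancel)
    moreover have "c \<sigma> = d \<sigma>"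
      unfolding c_def d_def using True w(1) match[OF \<sigma>] by (intro arg_cong2[where f = "(*)"] prod.cong) auto
    ultimately show ?thesis by simp
  next
    case False
    then obtain i where i: "i \<in> P" "\<sigma> i \<noteq> \<beta> i" by blast
    have "d \<sigma> = 0"
      unfolding d_def using match[OF \<sigma> i(1)] i P by (auto intro!: prod_zero)
    moreover have "c \<sigma> = 0" if eq: "E \<sigma> = E \<sigma>0"
    proof (rule ccontr)
      assume "c \<sigma> \<noteq> 0"
      then have "\<forall>i\<in>?U. (if i \<in> P then w i (\<sigma> i) else v i (\<sigma> i)) \<noteq> 0"
        by (auto simp: c_def)
      then have nonzero: "w i (\<sigma> i) \<noteq> 0" if "i \<in> P" for i
        using that P by (metis subsetD)
      have le: "(e (\<sigma> i), e (\<beta> i)) \<in> ord" if "i \<in> P" for i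
        using w(2)[OF that _ nonzero[OF that]] lt[OF \<sigma>] that P by blast
      have "(\<Sum>i\<in>P. e (\<sigma> i)) = (\<Sum>i\<in>P. e (\<sigma>0 i))"
        using total[OF \<sigma>] total[OF \<sigma>0(1)] eq by (metis add_left_cancel)
      also have "\<dots> = (\<Sum>i\<in>P. e (\<beta> i))" using \<sigma>0_P by simp
      finally have "e (\<sigma> i) = e (\<beta> i)"
        using term_order_sum_eq[OF ord finP, of "\<lambda>i. e (\<sigma> i)" "\<lambda>i. e (\<beta> i)"] le i(1) by blast
      then show False
        using inj_onD[OF e] i lt[OF \<sigma>] \<beta>[OF i(1)] P by fastforce
    qed
    ultimately show ?thesis by simp
  qed
  have same: "(\<forall>x\<in>UNIV. Poly_Mapping.lookup (E \<sigma>) x = Poly_Mapping.lookup (E \<sigma>0) x)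
    \<longleftrightarrow> E \<sigma> = E \<sigma>0" for \<sigma>
    using poly_mapping_eqI[of "E \<sigma>" "E \<sigma>0"] by auto
  \<comment> \<open>This is the coefficient at \<open>E \<sigma>0\<close> of the determinant as a
    polynomial in \<open>u\<close>.\<close>
  have "(\<Sum>\<sigma> | \<sigma> \<in> ?S \<and> (\<forall>x\<in>UNIV. Poly_Mapping.lookup (E \<sigma>) x = Poly_Mapping.lookup (E \<sigma>0) x). c \<sigma>)
    = (\<Sum>\<sigma>\<in>?S. if E \<sigma> = E \<sigma>0 then c \<sigma> else 0)"
    unfolding same by (rule sum.inter_filter[OF finS])
  also have "\<dots> = (\<Sum>\<sigma>\<in>?S. d \<sigma>)"
    by (rule sum.cong[OF refl]) (rule coeff)
  also have "\<dots> \<noteq> 0" using det unfolding det_v .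
  finally have "\<exists>u. (\<forall>x\<in>UNIV. u x \<noteq> 0) \<and>
      (\<Sum>\<sigma>\<in>?S. c \<sigma> * (\<Prod>x\<in>UNIV. u x ^ Poly_Mapping.lookup (E \<sigma>) x)) \<noteq> 0"
    by (rule monomial_combination_nonzero[OF inf finite_UNIV finS])
  then obtain u where "(\<Sum>\<sigma>\<in>?S. c \<sigma> * monomial_value u (E \<sigma>)) \<noteq> 0"
    unfolding monomial_value_def by blast
  then show ?thesis unfolding det_u[symmetric] by blast
qed

section \<open>Coefficient matrices and independence of forms\<close>

lemma det_lookup_nonzero_iff:
  fixes b :: "nat \<Rightarrow> ('n::finite, 'k::field) mpoly"
  assumes e: "bij_betw e {0..<N} {t. total_degree t = n}" and b: "\<And>i. i < N \<Longrightarrow> b i \<in> homog n"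
  shows "Determinant.det (mat N N (\<lambda>(i, j). Poly_Mapping.lookup (b i) (e j))) \<noteq> 0
    \<longleftrightarrow> indep_mod {0} b {0..<N}"
proof -
  let ?A = "mat N N (\<lambda>(i, j). Poly_Mapping.lookup (b i) (e j))"
  have sum: "(\<Sum>i\<in>{0..<N}. kscale (c i) (b i)) = 0
    \<longleftrightarrow> (\<forall>j<N. (\<Sum>i\<in>{0..<N}. c i * Poly_Mapping.lookup (b i) (e j)) = 0)" (is "?f = 0 \<longleftrightarrow> ?R") for c
  proof
    assume "?f = 0"
    then have "Poly_Mapping.lookup ?f (e j) = 0" for j by simp
    then show ?R by (simp add: lookup_sum)
  next
    assume R: ?R
    show "?f = 0"
    proof (rule poly_mapping_eqI)
      fix t
      show "Poly_Mapping.lookup ?f t = Poly_Mapping.lookup 0 t"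
      proof (cases "total_degree t = n")
        case True
        then have "t \<in> e ` {0..<N}" using e by (auto simp: bij_betw_def)
        then show ?thesis using R by (auto simp: lookup_sum)
      next
        case False
        then have "Poly_Mapping.lookup (b i) t = 0" if "i < N" for i
          using b[OF that] by (auto simp: homogeneous_of_degree_def in_keys_iff)
        then show ?thesis by (simp add: lookup_sum)
      qed
    qed
  qed
  \<comment> \<open>The rows are the polynomials, so a relation among them is a kernel vector of the
    transpose.\<close>
  have "Determinant.det ?A = Determinant.det (transpose_mat ?A)"
    by (rule det_transpose[where n = N, symmetric]) simp
  also have "\<dots> = 0 \<longleftrightarrow> (\<exists>x. x \<in> carrier_vec N \<and> x \<noteq> 0\<^sub>v N \<and> transpose_mat ?A *\<^sub>v x = 0\<^sub>v N)"
    by (rule det_0_iff_vec_prod_zero_field) simp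
  also have "\<dots> \<longleftrightarrow> (\<exists>c. (\<Sum>i\<in>{0..<N}. kscale (c i) (b i)) = 0 \<and> (\<exists>i<N. c i \<noteq> 0))"
  proof
    assume "\<exists>x. x \<in> carrier_vec N \<and> x \<noteq> 0\<^sub>v N \<and> transpose_mat ?A *\<^sub>v x = 0\<^sub>v N"
    then obtain x where x: "x \<in> carrier_vec N" "x \<noteq> 0\<^sub>v N" "transpose_mat ?A *\<^sub>v x = 0\<^sub>v N" by blast
    have "(\<Sum>i\<in>{0..<N}. x $ i * Poly_Mapping.lookup (b i) (e j)) = 0" if "j < N" for j
    proof -
      have "(transpose_mat ?A *\<^sub>v x) $ j = 0" using x(3) that by simp
      then show ?thesis using that x(1) by (simp add: scalar_prod_def mult.commute)
    qed
    moreover have "\<exists>i<N. x $ i \<noteq> 0" using x(1,2) by (metis eq_vecI carrier_vecD index_zero_vec)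
    ultimately show "\<exists>c. (\<Sum>i\<in>{0..<N}. kscale (c i) (b i)) = 0 \<and> (\<exists>i<N. c i \<noteq> 0)"
      unfolding sum by blast
  next
    assume "\<exists>c. (\<Sum>i\<in>{0..<N}. kscale (c i) (b i)) = 0 \<and> (\<exists>i<N. c i \<noteq> 0)"
    then obtain c i where c: "\<forall>j<N. (\<Sum>i\<in>{0..<N}. c i * Poly_Mapping.lookup (b i) (e j)) = 0" "i < N" "c i \<noteq> 0"
      unfolding sum by blast
    have "vec N c \<noteq> 0\<^sub>v N" using c(2,3) by (metis index_vec index_zero_vec(1))
    moreover have "transpose_mat ?A *\<^sub>v vec N c = 0\<^sub>v N"
      using c(1) by (intro eq_vecI) (auto simp: scalar_prod_def mult.commute)
    ultimately show "\<exists>x. x \<in> carrier_vec N \<and> x \<noteq> 0\<^sub>v N \<and> transpose_mat ?A *\<^sub>v x = 0\<^sub>v N"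
      by (intro exI[of _ "vec N c"]) simp
  qed
  finally show ?thesis unfolding indep_mod_def by auto
qed

lemma subspace_zero: "K.subspace {0}"
  by (simp add: K.subspace_def)

lemma indep_xpow: "finite T \<Longrightarrow> indep_mod {0} xpow T"
proof (unfold indep_mod_def, intro allI impI ballI)
  fix c :: "'a monomial \<Rightarrow> 'b" and t
  assume fin: "finite T" and sum: "(\<Sum>t\<in>T. kscale (c t) (xpow t)) \<in> {0}" and t: "t \<in> T"
  have "Poly_Mapping.lookup (\<Sum>t\<in>T. kscale (c t) (xpow t)) t = (\<Sum>s\<in>T. if s = t then c s else 0)"
    unfolding lookup_sum lookup_kscale by (rule sum.cong) (auto simp: lookup_single)
  then show "c t = 0" using sum fin t by simp
qed

lemma indep_mod_zero_bij:
  assumes "bij_betw f A B" and B: "K.independent B" and fin: "finite A"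
  shows "indep_mod {0} f A"
  unfolding indep_mod_def
proof (intro allI impI ballI)
  fix c a assume sum: "(\<Sum>a\<in>A. kscale (c a) (f a)) \<in> {0}" and a: "a \<in> A"
  have inj: "inj_on f A" and img: "f ` A = B" using assms(1) by (auto simp: bij_betw_def)
  have "(\<Sum>x\<in>B. kscale (c (the_inv_into A f x)) x) = (\<Sum>a\<in>A. kscale (c a) (f a))"
    unfolding img[symmetric] sum.reindex[OF inj] o_def
    by (rule sum.cong) (auto simp: the_inv_into_f_f[OF inj])
  then have "c (the_inv_into A f (f a)) = 0"
    using sum a fin img by (intro K.independentD[OF B, of B]) auto
  then show "c a = 0" by (simp add: the_inv_into_f_f[OF inj a])
qed

lemma independent_xpow:
  assumes "finite T"
  shows "K.independent (xpow ` T :: ('n::finite, 'k::field) mpoly set)"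
proof (rule K.independent_if_scalars_zero)
  fix f :: "('n, 'k) mpoly \<Rightarrow> 'k" and x :: "('n, 'k) mpoly"
  assume sum: "(\<Sum>x\<in>xpow ` T. kscale (f x) x) = 0" and x: "x \<in> xpow ` T"
  have "inj_on (xpow :: 'n monomial \<Rightarrow> ('n, 'k) mpoly) T"
    by (rule inj_onI) (drule arg_cong[where f = Poly_Mapping.keys], simp)
  then have "(\<Sum>t\<in>T. kscale (f (xpow t)) (xpow t)) \<in> {0}"
    using sum by (simp add: sum.reindex)
  then show "f x = 0"
    using indep_modD[OF indep_xpow[OF assms], of "\<lambda>t. f (xpow t)"] x by blast
qed (use assms in simp)

lemma exists_reduction_lift:
  fixes I :: "('n::finite, 'k::field) mpoly set"
  assumes inf: "infinite (UNIV :: 'k set)" and ord: "term_order ord"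
    and I: "R.subspace I" "graded I"
    and Z: "Z \<subseteq> homog 1" "homog (Suc r) \<subseteq> R.span (initial_ideal ord I \<union> Z)"
  shows "\<exists>u. homog (Suc r) \<subseteq> R.span (I \<union> rescale u ` Z)"
proof -
  let ?J = "initial_ideal ord I" and ?M = "initial_monomials ord I" and ?D = "{t :: 'n monomial. total_degree t = Suc r}"
  let ?B0 = "(xpow :: _ \<Rightarrow> ('n, 'k) mpoly) ` (?M \<inter> ?D)" and ?L = "{xpow t * l | t l. total_degree t = r \<and> l \<in> Z}"
  let ?X = "xpow ` ?D :: ('n, 'k) mpoly set"
  have xpow: "(xpow t :: ('n, 'k) mpoly) \<in> homog (total_degree t)" for t by (rule xpow_homog)
  have L: "?L \<subseteq> homog (Suc r)"
  proof
    fix f assume "f \<in> ?L"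
    then obtain t l where "f = xpow t * l" "total_degree t = r" "l \<in> homog 1" using Z(1) by blast
    then show "f \<in> homog (Suc r)" using homog_mult[OF xpow, of l 1 t] by simp
  qed
  \<comment> \<open>Taking parts of degree \<open>r + 1\<close> leaves of the initial ideal only
    combinations of its monomials of that degree.\<close>
  have "homog (Suc r) \<subseteq> K.span (?B0 \<union> ?L)"
  proof
    fix f :: "('n, 'k) mpoly" assume f: "f \<in> homog (Suc r)"
    let ?V = "{g. hom_part (Suc r) g \<in> K.span (?B0 \<union> ?L)}"
    have "f \<in> R.span (?J \<union> Z)" using Z(2) f by blast
    from homog_in_span_linear[OF subspace_initial_ideal graded_initial_ideal Z(1) this f]
    have "f \<in> K.span (?J \<union> ?L)" .
    moreover have "K.subspace ?V"
      by (simp add: K.subspace_def K.span_zero hom_part_add hom_part_kscale K.span_add K.span_scale)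
    moreover have "?J \<subseteq> ?V"
    proof
      fix g assume g: "g \<in> ?J"
      have "Poly_Mapping.keys (hom_part (Suc r) g) \<subseteq> ?M \<inter> ?D"
        using g by (auto simp: initial_ideal_eq[OF ord I(1)] in_keys_iff lookup_hom_part when_def split: if_splits)
      then have "hom_part (Suc r) g \<in> K.span (?B0 \<union> ?L)"
        by (intro mpoly_in_span_monomials[OF K.span_base]) blast
      then show "g \<in> ?V" by simp
    qed
    moreover have "?L \<subseteq> ?V"
    proof
      fix g assume g: "g \<in> ?L"
      then have "hom_part (Suc r) g = g" using L by (simp add: hom_part_of_homog[of g "Suc r"] subset_iff)
      then show "g \<in> ?V" using g by (simp add: K.span_base)
    qed
    ultimately have "f \<in> ?V" using K.span_minimal[of "?J \<union> ?L" ?V] by blast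
    then show "f \<in> K.span (?B0 \<union> ?L)" using hom_part_of_homog[OF f, of "Suc r"] by simp
  qed
  moreover obtain B where B: "?B0 \<subseteq> B" "B \<subseteq> ?B0 \<union> ?L" "K.independent B" "?B0 \<union> ?L \<subseteq> K.span B"
  proof (rule K.maximal_independent_subset_extend)
    show "?B0 \<subseteq> ?B0 \<union> ?L" by blast
    show "K.independent ?B0"
      by (intro independent_xpow finite_Int disjI2 finite_exponents_total_degree)
  qed
  moreover have "K.span (?B0 \<union> ?L) \<subseteq> K.span B" by (rule K.span_minimal[OF B(4) K.subspace_span])
  ultimately have span_B: "homog (Suc r) \<subseteq> K.span B" by blast
  have X_homog: "?X \<subseteq> homog (Suc r)" 
  proof (rule image_subsetI)
    fix t assume "t \<in> ?D"
    then show "(xpow t :: ('n, 'k) mpoly) \<in> homog (Suc r)" using xpow[of t] by simp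
  qed
  then have B_homog: "B \<subseteq> homog (Suc r)" using B(2) L by blast
  have finX: "finite ?X" by (intro finite_imageI finite_exponents_total_degree)
  have finB: "finite B" and card_B: "card B \<le> card ?X"
    using K.independent_span_bound[OF finX B(3)] B_homog homog_subset_span_monomials by blast+
  \<comment> \<open>The monomials are independent and lie in the span of \<open>B\<close>, and
    conversely; equal sizes make the coefficient matrix square.\<close>
  have "card ?D \<le> card B"
  proof (rule indep_mod_card_le[OF subspace_zero _ finB indep_xpow])
    show "(xpow t :: ('n, 'k) mpoly) \<in> K.span ({0} \<union> B)" if "t \<in> ?D" for t
      using that span_B X_homog K.span_mono[of B "{0} \<union> B"] by blast
  qed (rule finite_exponents_total_degree)+
  then have card: "card B = card ?D"
    using card_B card_image_le[OF finite_exponents_total_degree[of "Suc r"], where f = "xpow :: _ \<Rightarrow> ('n, 'k) mpoly"] by simp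
  define N where "N = card ?D"
  obtain e where e: "bij_betw e {0..<N} ?D"
    using ex_bij_betw_nat_finite[OF finite_exponents_total_degree[of "Suc r"]] N_def by blast
  obtain b where b: "bij_betw b {0..<N} B"
    using ex_bij_betw_nat_finite[OF finB] card N_def by metis
  have b_homog: "b i \<in> homog (Suc r)" if "i < N" for i
    using bij_betw_apply[OF b, of i] B_homog that by auto
  have det_b: "Determinant.det (mat N N (\<lambda>(i, j). Poly_Mapping.lookup (b i) (e j))) \<noteq> 0"
    using det_lookup_nonzero_iff[of e N "Suc r" b, OF e b_homog] indep_mod_zero_bij[OF b B(3)] by blast
  \<comment> \<open>The basis elements that are initial monomials; all others are multiples of
    elements of \<open>Z\<close>.\<close>
  define P where "P = {i \<in> {0..<N}. b i \<in> ?B0}"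
  have "\<exists>j f. j < N \<and> b i = xpow (e j) \<and> f \<in> I \<and> f \<in> homog (Suc r) \<and> Poly_Mapping.lookup f (e j) = 1
    \<and> (\<forall>s\<in>Poly_Mapping.keys f. (s, e j) \<in> ord)" if i: "i \<in> P" for i
  proof -
    obtain t where t: "t \<in> ?M" "t \<in> ?D" "b i = xpow t" using i by (auto simp: P_def)
    have "t \<in> e ` {0..<N}" using t(2) e unfolding bij_betw_def by blast
    then obtain j where j: "j < N" "t = e j" by auto
    obtain f where "f \<in> I" "f \<in> homog (total_degree t)" "Poly_Mapping.lookup f t = 1"
      "\<forall>s\<in>Poly_Mapping.keys f. (s, t) \<in> ord"
      using initial_monomial_witness[OF ord I t(1)] by blast
    then show ?thesis using t j by (intro exI[of _ j] exI[of _ f]) auto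
  qed
  then have "\<forall>i\<in>P. \<exists>j f. j < N \<and> b i = xpow (e j) \<and> f \<in> I \<and> f \<in> homog (Suc r)
    \<and> Poly_Mapping.lookup f (e j) = 1 \<and> (\<forall>s\<in>Poly_Mapping.keys f. (s, e j) \<in> ord)" by blast
  then obtain \<beta> w where \<beta>: "\<And>i. i \<in> P \<Longrightarrow> \<beta> i < N" "\<And>i. i \<in> P \<Longrightarrow> b i = xpow (e (\<beta> i))"
    and w: "\<And>i. i \<in> P \<Longrightarrow> w i \<in> I" "\<And>i. i \<in> P \<Longrightarrow> w i \<in> homog (Suc r)"
      "\<And>i. i \<in> P \<Longrightarrow> Poly_Mapping.lookup (w i) (e (\<beta> i)) = 1"
      "\<And>i s. i \<in> P \<Longrightarrow> s \<in> Poly_Mapping.keys (w i) \<Longrightarrow> (s, e (\<beta> i)) \<in> ord"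
    unfolding bchoice_iff by blast
  have inj_e: "inj_on e {0..<N}" using e by (simp add: bij_betw_def)
  have "\<exists>u. Determinant.det (mat N N (\<lambda>(i, j). if i \<in> P then Poly_Mapping.lookup (w i) (e j)
      else monomial_value u (e j) * Poly_Mapping.lookup (b i) (e j))) \<noteq> 0"
  proof (rule det_rescaled_nonzero[where v = "\<lambda>i j. Poly_Mapping.lookup (b i) (e j)"
        and w = "\<lambda>i j. Poly_Mapping.lookup (w i) (e j)" and \<beta> = \<beta>, OF inf ord inj_e _ \<beta>(1) _ w(3) _ det_b])
    show "P \<subseteq> {0..<N}" by (auto simp: P_def)
    show "Poly_Mapping.lookup (b i) (e j) = (if j = \<beta> i then 1 else 0)" if "i \<in> P" "j < N" for i j
      using \<beta>(1)[OF that(1)] that(2) inj_onD[OF inj_e, of j "\<beta> i"]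
      by (auto simp: \<beta>(2)[OF that(1)] lookup_single when_def)
    show "(e j, e (\<beta> i)) \<in> ord" if "i \<in> P" "Poly_Mapping.lookup (w i) (e j) \<noteq> 0" for i j
      using w(4)[OF that(1)] that(2) by (simp add: in_keys_iff)
  qed
  then obtain u where u: "Determinant.det (mat N N (\<lambda>(i, j). if i \<in> P then Poly_Mapping.lookup (w i) (e j)
      else monomial_value u (e j) * Poly_Mapping.lookup (b i) (e j))) \<noteq> 0" by blast
  define v where "v = (\<lambda>i. if i \<in> P then w i else rescale u (b i))"
  have v_homog: "v i \<in> homog (Suc r)" if "i < N" for i
    using w(2) rescale_homog[OF b_homog[OF that]] by (auto simp: v_def)
  have "(\<lambda>(i, j). Poly_Mapping.lookup (v i) (e j)) = (\<lambda>(i, j). if i \<in> P then Poly_Mapping.lookup (w i) (e j)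
      else monomial_value u (e j) * Poly_Mapping.lookup (b i) (e j))"
    by (auto simp: v_def fun_eq_iff)
  with u have indep_v: "indep_mod {0} v {0..<N}"
    using det_lookup_nonzero_iff[of e N "Suc r" v, OF e v_homog] by simp
  have "homog (Suc r) \<subseteq> K.span ({0} \<union> v ` {0..<N})"
  proof (rule subsetI, rule ccontr)
    fix f assume f: "f \<in> homog (Suc r)" "f \<notin> K.span ({0} \<union> v ` {0..<N})"
    \<comment> \<open>A form outside the span, placed at the fresh index \<open>N\<close>, would
      give \<open>N + 1\<close> independent forms in a space of dimension at most
      \<open>N\<close>.\<close>
    let ?v = "v(N := f)"
    have "indep_mod {0} ?v {0..<N}" using indep_v by (simp add: indep_mod_def)
    moreover have "?v ` {0..<N} = v ` {0..<N}" by auto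
    ultimately have ins: "indep_mod {0} ?v (insert N {0..<N})"
      using f(2) by (intro indep_mod_insert) auto
    have "card (insert N {0..<N}) \<le> card ?X"
    proof (rule indep_mod_card_le[OF subspace_zero _ finX ins])
      fix i assume "i \<in> insert N {0..<N}"
      then have "?v i \<in> homog (Suc r)" using f(1) v_homog by auto
      then show "?v i \<in> K.span ({0} \<union> ?X)"
        using homog_subset_span_monomials[of "Suc r"] K.span_mono[of ?X "{0} \<union> ?X"] by blast
    qed simp
    also have "\<dots> \<le> N" unfolding N_def by (intro card_image_le finite_exponents_total_degree)
    finally show False by simp
  qed
  also have "\<dots> \<subseteq> R.span (I \<union> rescale u ` Z)"
  proof (rule K.span_minimal[OF _ subspace_K[OF R.subspace_span]])
    have "v i \<in> R.span (I \<union> rescale u ` Z)" if i: "i < N" for i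
    proof (cases "i \<in> P")
      case True
      then show ?thesis using w(1) by (auto simp: v_def intro: R.span_base)
    next
      case False
      then have "b i \<in> ?L" using i bij_betw_apply[OF b, of i] B(2) by (auto simp: P_def)
      then obtain t l where t: "b i = xpow t * l" "l \<in> Z" by blast
      \<comment> \<open>Rescaling a monomial multiple of \<open>l\<close> gives a multiple of the
        rescaled \<open>l\<close>.\<close>
      have "kscale (monomial_value u t) (xpow t) * rescale u l \<in> R.span (I \<union> rescale u ` Z)"
        using t(2) by (intro R.span_scale R.span_base) blast
      then show ?thesis using False by (simp add: v_def t(1) rescale_xpow_mult)
    qed
    then show "{0} \<union> v ` {0..<N} \<subseteq> R.span (I \<union> rescale u ` Z)" by (auto simp: R.span_zero)
  qed
  finally show ?thesis by blast
qed

theorem corollary3p4: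
  fixes I :: "('n::finite, 'k::field) mpoly set"
    and ord :: "'n monomial rel"
  assumes "infinite (UNIV :: 'k set)"
    and "ideal I mpoly_ring"
    and "I \<noteq> carrier mpoly_ring"
    and "homogeneous_ideal I"
    and "term_order ord"
  shows "reduction_number (mpoly_ring Quot I) (quotient_grading I)
       \<le> reduction_number (mpoly_ring Quot (initial_ideal ord I))
            (quotient_grading (initial_ideal ord I))"
proof -
  let ?J = "initial_ideal ord I"
  let ?red = "\<lambda>J L. LEAST n. homog (n + 1) \<subseteq> R.span (J \<union> L)"
  have I: "R.subspace I" using assms(2) by (simp add: ideal_iff_subspace)
  have gI: "graded I"
  proof -
    obtain S where "\<forall>f\<in>S. \<exists>n. homogeneous_of_degree n f" "I = R.span S"
      using assms(4) unfolding homogeneous_ideal_def genideal_eq_span by blast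
    then show ?thesis using graded_span[of S] by simp
  qed
  have "{?red ?J L | L. minimally_reduces ?J L} \<noteq> {}"
    using exists_minimally_reduces[OF subspace_initial_ideal graded_initial_ideal] by blast
  then have "Inf {?red ?J L | L. minimally_reduces ?J L} \<in> {?red ?J L | L. minimally_reduces ?J L}"
    by (rule Inf_nat_def1)
  then obtain L where L: "minimally_reduces ?J L" "Inf {?red ?J L | L. minimally_reduces ?J L} = ?red ?J L"
    by blast
  define r where "r = ?red ?J L"
  have "reduces ?J L" using L(1) by (simp add: minimally_reduces_def)
  \<comment> \<open>The minimum is attained at \<open>L\<close>; independent generators
    \<open>Z\<close> give the same ideal, hence the same number \<open>r\<close> and again a minimal
    reduction.\<close>
  then obtain Z where Z: "finite Z" "Z \<subseteq> homog 1" "indep_mod ?J id Z"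
    "R.span (?J \<union> Z) = R.span (?J \<union> L)" "reduces ?J Z"
    by (rule reduces_independent_generators[OF subspace_initial_ideal])
  have min_Z: "minimally_reduces ?J Z"
    using L(1) Z(4,5) by (simp add: minimally_reduces_def)
  \<comment> \<open>Some degree satisfies the condition, so the \<open>LEAST\<close> defining
    \<open>r\<close> satisfies it too.\<close>
  obtain N where "\<forall>n\<ge>N. homog n \<subseteq> R.span (?J \<union> L)"
    using \<open>reduces ?J L\<close> by (auto simp: reduces_def)
  then have "homog (N + 1) \<subseteq> R.span (?J \<union> L)" by simp
  then have "homog (r + 1) \<subseteq> R.span (?J \<union> L)" unfolding r_def by (rule LeastI)
  then have "homog (Suc r) \<subseteq> R.span (?J \<union> Z)" by (simp add: Z(4))
  then obtain u where u: "homog (Suc r) \<subseteq> R.span (I \<union> rescale u ` Z)"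
    using exists_reduction_lift[OF assms(1,5) I gI Z(2)] by blast
  have Y: "reduces I (rescale u ` Z)"
    using Z(2) rescale_homog by (intro reducesI[OF _ u]) blast
  \<comment> \<open>The rescaled set has at most \<open>card Z\<close> elements, and no finite
    reducing set for \<open>I\<close> has fewer than \<open>card Z\<close>.\<close>
  have "minimally_reduces I (rescale u ` Z)"
  proof (rule minimally_reducesI[OF I gI _ Y])
    show "card (rescale u ` Z) \<le> card Z'" if "finite Z'" "reduces I Z'" for Z'
      using card_image_le[OF Z(1), of "rescale u"]
        card_minimal_reduction_le[OF assms(1,5) I gI Z(1,3) min_Z that] by linarith
  qed (use Z(1) in simp)
  then have "Inf {?red I L | L. minimally_reduces I L} \<le> ?red I (rescale u ` Z)"
    by (intro wellorder_Inf_le1) blast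
  also have "\<dots> \<le> r" by (rule Least_le) (use u in simp)
  finally show ?thesis
    unfolding reduction_number_quotient[OF I] reduction_number_quotient[OF subspace_initial_ideal] L(2) r_def .
qed

end
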